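(* For all integers $n>1$ and $k\ge 3$, the firecracker graph $F_{n,k}$ is odd prime.
   Context: All graphs are finite and simple. A graph $G$ of order $N$ is odd prime if there is a bijection $\ell:V(G)\to\{1,3,\ldots,2N-1\}$ with $\gcd(\ell(u),\ell(v))=1$ for every edge $uv$. The firecracker $F_{n,k}$ consists of a path $v_1,\ldots,v_n$ and, for each $i$, a star with center $u_i$ and $k-2$ leaves $w_{i,1},\ldots,w_{i,k-2}$ (a star on $k-1$ vertices), together with the edge $v_iu_i$; it has $nk$ vertices. *)

theory Defs
  imports Main
begin

definition simple_graph :: "'a set \<Rightarrow> 'a set set \<Rightarrow> bool" where
  "simple_graph V E \<longleftrightarrow> finite V \<and> (\<forall>e\<in>E. e \<subseteq> V \<and> card e = 2)"

definition odd_prime_labeling :: "'a set \<Rightarrow> 'a set set \<Rightarrow> ('a \<Rightarrow> nat) \<Rightarrow> bool" where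
  "odd_prime_labeling V E l \<longleftrightarrow>
     bij_betw l V {2 * i + 1 | i. i < card V} \<and>
     (\<forall>u v. {u, v} \<in> E \<longrightarrow> coprime (l u) (l v))"

definition odd_prime :: "'a set \<Rightarrow> 'a set set \<Rightarrow> bool" where
  "odd_prime V E \<longleftrightarrow> (\<exists>l. odd_prime_labeling V E l)"

text \<open>Vertices of the firecracker: path vertices v_i, star centres u_i, leaves w_{i,j}.\<close>

datatype fc_vertex = FV nat | FU nat | FW nat nat

definition firecracker_vertices :: "nat \<Rightarrow> nat \<Rightarrow> fc_vertex set" where
  "firecracker_vertices n k =
     {FV i | i. 1 \<le> i \<and> i \<le> n} \<union> {FU i | i. 1 \<le> i \<and> i \<le> n} \<union>
     {FW i j | i j. 1 \<le> i \<and> i \<le> n \<and> 1 \<le> j \<and> j \<le> k - 2}"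

definition firecracker_edges :: "nat \<Rightarrow> nat \<Rightarrow> fc_vertex set set" where
  "firecracker_edges n k =
     {{FV i, FV (i + 1)} | i. 1 \<le> i \<and> i < n} \<union>
     {{FV i, FU i} | i. 1 \<le> i \<and> i \<le> n} \<union>
     {{FU i, FW i j} | i j. 1 \<le> i \<and> i \<le> n \<and> 1 \<le> j \<and> j \<le> k - 2}"

end

theory Submission
  imports Defs "HOL-Number_Theory.Number_Theory"
begin

text \<open>
  If \<open>k \<le> 17\<close>, the \<open>i\<close>-th star together with its path vertex receives the \<open>i\<close>-th block of \<open>k\<close>
  consecutive odd numbers. The path gets the first element of each block, which is 1 modulo \<open>2 k\<close>,
  and some other element of the block is coprime to the rest of the block and serves as centre.

  If \<open>k \<ge> 18\<close>, put \<open>N = n k\<close>. The path is labelled 3, 5, ..., \<open>2 n + 1\<close>, and the centres are chosen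
  so that the other labels can be attached greedily: if the centres are \<open>u\<^sub>0, ..., u\<^sub>n\<^sub>-\<^sub>1\<close>, it suffices that
  at most \<open>j\<close> path labels and at most \<open>(k - 2) j\<close> leaf labels share a factor with \<open>u\<^sub>j\<close>. Take \<open>u\<^sub>0 = 1\<close>;
  next come the primes between \<open>2 n + 1\<close> and \<open>2 N\<close>, which have fewer than \<open>k\<close> odd multiples each.
  Chebyshev's bounds provide at least \<open>4 N / (5 ln (2 N))\<close> of them, or all that are needed if
  \<open>ln (2 N) \<le> 12\<close>. For the remaining \<open>j\<close> it is enough that the sum of \<open>1/p\<close> over the primes \<open>p\<close>
  dividing \<open>u\<^sub>j\<close> is at most \<open>2 j / (5 n)\<close>. Since now \<open>j/n\<close> is at least a constant over \<open>ln (2 N)\<close>, numbers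
  without prime factors up to about \<open>5 n / (2 j)\<close> can be counted through a primorial period that is a
  small power of \<open>N\<close>, and on average their sum is small enough.
\<close>

section \<open>Assignments and labels\<close>

text \<open>Serve the indices in the order \<open>n - 1, ..., 1, 0\<close>: when \<open>j\<close> is served, \<open>c (j + 1)\<close> elements
  remain, of which at most \<open>c j\<close> are bad for it.\<close>
lemma greedy_assignment:
  fixes good :: "nat \<Rightarrow> 'a \<Rightarrow> bool"
  assumes "finite W" "card W = c * n"
    and "\<And>j. j < n \<Longrightarrow> card {w \<in> W. \<not> good j w} \<le> c * j"
  shows "\<exists>f. bij_betw f ({..<n} \<times> {..<c}) W \<and> (\<forall>j<n. \<forall>i<c. good j (f (j, i)))"
  using assms
proof (induction n arbitrary: W)
  case 0
  then have "W = {}" by simp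
  then show ?case by (auto simp: bij_betw_def)
next
  case (Suc n)
  let ?B = "{w \<in> W. \<not> good n w}" and ?G = "{w \<in> W. good n w}"
  have "card W = card ?G + card ?B"
    using Suc.prems(1) by (subst card_Un_disjoint [symmetric]) (auto intro!: arg_cong [where f = card])
  then have "c \<le> card ?G"
    using Suc.prems(2) Suc.prems(3)[of n] by simp
  then obtain S where S: "S \<subseteq> ?G" "card S = c" "finite S"
    by (meson obtain_subset_with_card_n)
  have "card (W - S) = c * n"
    using S Suc.prems(1,2) by (subst card_Diff_subset) auto
  moreover have "card {w \<in> W - S. \<not> good j w} \<le> c * j" if "j < n" for j
    using Suc.prems(3)[of j] that Suc.prems(1)
      card_mono[of "{w \<in> W. \<not> good j w}" "{w \<in> W - S. \<not> good j w}"] by fastforce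
  ultimately obtain f where f: "bij_betw f ({..<n} \<times> {..<c}) (W - S)"
      "\<forall>j<n. \<forall>i<c. good j (f (j, i))"
    using Suc.IH[of "W - S"] Suc.prems(1) by blast
  obtain h where h: "bij_betw h {..<c} S"
    using S by (metis ex_bij_betw_nat_finite atLeast0LessThan)
  define g where "g = (\<lambda>(j, i). if j = n then h i else f (j, i))"
  have "bij_betw g ({..<n} \<times> {..<c}) (W - S)"
    using f(1) by (rule bij_betw_cong [THEN iffD1, rotated]) (auto simp: g_def)
  moreover have "bij_betw g ({n} \<times> {..<c}) S"
  proof -
    have "bij_betw snd ({n} \<times> {..<c}) {..<c}"
      by (auto simp: bij_betw_def inj_on_def)
    from bij_betw_trans [OF this h] show ?thesis
      by (rule bij_betw_cong [THEN iffD1, rotated]) (auto simp: g_def)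
  qed
  ultimately have "bij_betw g ({..<n} \<times> {..<c} \<union> {n} \<times> {..<c}) ((W - S) \<union> S)"
    by (rule bij_betw_combine) auto
  moreover have "{..<n} \<times> {..<c} \<union> {n} \<times> {..<c} = {..<Suc n} \<times> {..<c}"
    by auto
  moreover have "(W - S) \<union> S = W"
    using S by auto
  moreover have "good j (g (j, i))" if "j < Suc n" "i < c" for j i
    using that f(2) h S(1) by (auto simp: g_def less_Suc_eq bij_betw_def)
  ultimately show ?case by auto
qed

text \<open>The easiest case of Hall's condition: choosing in the order of \<open>j\<close>, only
  \<open>j - 1\<close> elements have been taken from the sets when \<open>j\<close> is reached, and
  \<open>G j\<close> has at least \<open>j\<close>. The value \<open>a\<close> at index 0 lies in no
  \<open>G j\<close>, so it never competes.\<close>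

lemma distinct_representatives:
  fixes G :: "nat \<Rightarrow> 'a set"
  assumes "\<And>j. 1 \<le> j \<Longrightarrow> j < n \<Longrightarrow> finite (G j) \<and> j \<le> card (G j)"
    and "\<And>j. a \<notin> G j"
  shows "\<exists>u. u 0 = a \<and> inj_on u {..<n} \<and> (\<forall>j. 1 \<le> j \<longrightarrow> j < n \<longrightarrow> u j \<in> G j)"
  using assms
proof (induction n)
  case 0
  then show ?case by (intro exI [of _ "\<lambda>_. a"]) auto
next
  case (Suc n)
  then obtain u where u: "u 0 = a" "inj_on u {..<n}" "\<And>j. 1 \<le> j \<Longrightarrow> j < n \<Longrightarrow> u j \<in> G j"
    by (metis less_SucI)
  show ?case
  proof (cases "n = 0")
    case True
    then show ?thesis by (intro exI [of _ "\<lambda>_. a"]) (auto simp: lessThan_Suc)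
  next
    case False
    have "card (u ` {1..<n}) \<le> n - 1"
      using card_image_le [of "{1..<n}" u] by simp
    also have "\<dots> < card (G n)"
      using Suc.prems(1)[of n] False by linarith
    finally obtain b where b: "b \<in> G n" "b \<notin> u ` {1..<n}"
      by (meson card_mono finite_atLeastLessThan finite_imageI not_le subsetI)
    then have "b \<notin> u ` {..<n}"
      using u(1) Suc.prems(2)[of n] by (force simp: image_iff Suc_le_eq)
    then have "inj_on (u(n := b)) {..<Suc n}"
      using u(2) by (auto simp: inj_on_def less_Suc_eq image_iff)
    moreover have "(u(n := b)) 0 = a" "\<forall>j. 1 \<le> j \<longrightarrow> j < Suc n \<longrightarrow> (u(n := b)) j \<in> G j"
      using u b False by (auto simp: less_Suc_eq)
    ultimately show ?thesis by blast
  qed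
qed

lemma card_odd_less: "card {l::nat. odd l \<and> l < 2 * m} = m"
proof -
  have "{l. odd l \<and> l < 2 * m} = (\<lambda>i. 2 * i + 1) ` {..<m}"
    by (auto elim!: oddE)
  then show ?thesis by (simp add: card_image inj_on_def)
qed

text \<open>There are at most \<open>n * k\<close> vertices and exactly \<open>n * k\<close> labels,
  so a labelling that reaches every label is automatically injective.\<close>

lemma odd_prime_firecrackerI:
  assumes k: "k \<ge> 3"
    and onto: "v ` {1..n} \<union> u ` {1..n} \<union> (\<lambda>(i, j). w i j) ` ({1..n} \<times> {1..k - 2})
                 = {l::nat. odd l \<and> l < 2 * (n * k)}"
    and vv: "\<And>i. 1 \<le> i \<Longrightarrow> i < n \<Longrightarrow> coprime (v i) (v (i + 1))"
    and uv: "\<And>i. 1 \<le> i \<Longrightarrow> i \<le> n \<Longrightarrow> coprime (v i) (u i)"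
    and uw: "\<And>i j. 1 \<le> i \<Longrightarrow> i \<le> n \<Longrightarrow> 1 \<le> j \<Longrightarrow> j \<le> k - 2 \<Longrightarrow> coprime (u i) (w i j)"
  shows "odd_prime (firecracker_vertices n k) (firecracker_edges n k)"
proof -
  let ?V = "firecracker_vertices n k"
  define l where "l x = (case x of FV i \<Rightarrow> v i | FU i \<Rightarrow> u i | FW i j \<Rightarrow> w i j)" for x
  have V: "?V = FV ` {1..n} \<union> FU ` {1..n} \<union> (\<lambda>(i, j). FW i j) ` ({1..n} \<times> {1..k - 2})"
    by (auto simp: firecracker_vertices_def)
  then have fin: "finite ?V" by simp
  have "card ?V \<le> card (FV ` {1..n}) + card (FU ` {1..n})
          + card ((\<lambda>(i, j). FW i j) ` ({1..n} \<times> {1..k - 2}))"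
    unfolding V by (meson add_mono_thms_linordered_semiring(3) card_Un_le order_trans)
  also have "\<dots> \<le> n + n + n * (k - 2)"
    by (intro add_mono order_trans [OF card_image_le]) auto
  also have "\<dots> = n * k"
    using k by (simp add: algebra_simps diff_mult_distrib2)
  finally have le: "card ?V \<le> n * k" .
  have img: "l ` ?V = {l. odd l \<and> l < 2 * (n * k)}"
    unfolding V onto [symmetric] image_Un image_image by (simp add: l_def case_prod_beta)
  then have "card (l ` ?V) = n * k"
    by (simp add: card_odd_less)
  with le card_image_le [OF fin, of l] have card: "card ?V = n * k" and "inj_on l ?V"
    by (auto intro: eq_card_imp_inj_on fin)
  moreover have "{l. odd l \<and> l < 2 * (n * k)} = {2 * i + 1 | i. i < n * k}"
    by (auto elim!: oddE)
  ultimately have "bij_betw l ?V {2 * i + 1 | i. i < card ?V}"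
    using img by (simp add: bij_betw_def)
  moreover have "coprime (l x) (l y)" if "{x, y} \<in> firecracker_edges n k" for x y
    using that vv uv uw
    by (auto simp: firecracker_edges_def l_def doubleton_eq_iff coprime_commute)
  ultimately show ?thesis
    unfolding odd_prime_def odd_prime_labeling_def by blast
qed

section \<open>Short stars\<close>

text \<open>A common prime is odd and divides twice the distance \<open>e\<close> of
  \<open>x\<close> and \<open>y\<close>, hence \<open>e\<close> itself, which is positive and at
  most \<open>D\<close>.\<close>

lemma coprime_odd_nearby:
  fixes x y D :: nat
  assumes "x \<noteq> y" "x \<le> y + D" "y \<le> x + D"
    and "\<And>p. prime p \<Longrightarrow> odd p \<Longrightarrow> p \<le> D \<Longrightarrow> \<not> p dvd 2 * x + 1"
  shows "coprime (2 * x + 1) (2 * y + 1)"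
proof (rule ccontr)
  assume "\<not> coprime (2 * x + 1) (2 * y + 1)"
  then have "gcd (2 * x + 1) (2 * y + 1) \<noteq> 1"
    by (metis coprime_iff_gcd_eq_1)
  then obtain p where p: "prime p" "p dvd 2 * x + 1" "p dvd 2 * y + 1"
    using prime_factor_nat [of "gcd (2 * x + 1) (2 * y + 1)"] by auto
  have "odd p"
    using p(2) by (metis dvd_trans even_plus_one_iff dvd_triv_left)
  define e where "e = (if x \<le> y then y - x else x - y)"
  have "p dvd 2 * e"
  proof (cases "x \<le> y")
    case True
    then show ?thesis
      using dvd_diff_nat [OF p(3,2)] by (simp add: e_def diff_mult_distrib2)
  next
    case False
    then show ?thesis
      using dvd_diff_nat [OF p(2,3)] by (simp add: e_def diff_mult_distrib2)
  qed
  then have "p dvd e"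
    using \<open>odd p\<close> by (simp add: coprime_dvd_mult_right_iff)
  moreover have "e > 0" "e \<le> D"
    using assms by (auto simp: e_def)
  ultimately have "p \<le> D"
    by (meson dvd_imp_le order_trans)
  then show False
    using assms(4) p \<open>odd p\<close> by blast
qed

lemma odd_prime_le_10:
  fixes p :: nat
  assumes "prime p" "odd p" "p \<le> 10"
  shows "p \<in> {3, 5, 7}"
proof -
  have "p \<noteq> 1" "p \<noteq> 9"
    using assms(1) by auto
  moreover have "p \<in> {1, 3, 5, 7, 9}"
    using assms(2,3) by (auto elim!: oddE)
  ultimately show ?thesis by blast
qed

text \<open>Of five consecutive candidates, 3 excludes at most two, and 5 and 7 exclude at most one each.\<close>
lemma exists_coprime_105_in_five:
  "\<exists>t\<le>4::nat. \<not> 3 dvd 2 * (x + t) + 1 \<and> \<not> 5 dvd 2 * (x + t) + 1 \<and> \<not> 7 dvd 2 * (x + t) + 1"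
proof (rule ccontr)
  define F where "F p t \<longleftrightarrow> p dvd 2 * (x + t) + 1" for p t :: nat
  assume "\<not> ?thesis"
  then have cover: "F 3 t \<or> F 5 t \<or> F 7 t" if "t \<le> 4" for t
    using that by (auto simp: F_def)
  have excl: "\<not> F p i \<or> \<not> F p j" if "i < j" "j < i + p" "odd p" for i j p
  proof (rule ccontr)
    assume "\<not> ?thesis"
    then have "p dvd (2 * (x + j) + 1) - (2 * (x + i) + 1)"
      unfolding F_def by (intro dvd_diff_nat) auto
    then have "p dvd 2 * (j - i)"
      by (simp add: diff_mult_distrib2)
    then have "p dvd j - i"
      using \<open>odd p\<close> by (simp add: coprime_dvd_mult_right_iff)
    then show False
      using that by (auto dest: dvd_imp_le)
  qed
  have "\<not> F 3 0 \<or> \<not> F 3 1" "\<not> F 3 0 \<or> \<not> F 3 2" "\<not> F 3 1 \<or> \<not> F 3 2" "\<not> F 3 1 \<or> \<not> F 3 3"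
    "\<not> F 3 2 \<or> \<not> F 3 3" "\<not> F 3 2 \<or> \<not> F 3 4" "\<not> F 3 3 \<or> \<not> F 3 4"
    by (rule excl; simp)+
  moreover have "\<not> F p 0 \<or> \<not> F p 1" "\<not> F p 0 \<or> \<not> F p 2" "\<not> F p 0 \<or> \<not> F p 3" "\<not> F p 0 \<or> \<not> F p 4"
    "\<not> F p 1 \<or> \<not> F p 2" "\<not> F p 1 \<or> \<not> F p 3" "\<not> F p 1 \<or> \<not> F p 4"
    "\<not> F p 2 \<or> \<not> F p 3" "\<not> F p 2 \<or> \<not> F p 4" "\<not> F p 3 \<or> \<not> F p 4" if "p \<in> {5, 7}" for p
    using that by (intro excl; auto)+
  note this [of 5] this [of 7]
  moreover have "F 3 0 \<or> F 5 0 \<or> F 7 0" "F 3 1 \<or> F 5 1 \<or> F 7 1" "F 3 2 \<or> F 5 2 \<or> F 7 2"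
    "F 3 3 \<or> F 5 3 \<or> F 7 3" "F 3 4 \<or> F 5 4 \<or> F 7 4"
    by (rule cover; simp)+
  ultimately show False
    by (simp only: insert_iff simp_thms) argo
qed

text \<open>Two odd numbers at distance at most 20 can only share the primes 3, 5, 7. If \<open>k \<ge> 6\<close>, the middle of
  the block leaves room for five consecutive candidates, and one of them avoids these primes.\<close>
lemma local_centre:
  fixes a k :: nat
  assumes "3 \<le> k" "k \<le> 17"
  shows "\<exists>c. 1 \<le> c \<and> c < k \<and> (\<forall>t<k. t \<noteq> c \<longrightarrow> coprime (2 * (a + c) + 1) (2 * (a + t) + 1))"
proof (cases "k \<le> 5")
  case True
  \<comment> \<open>The middle is at distance at most 2 from the rest of the block, and no odd prime
    is that small.\<close>
  have "coprime (2 * (a + k div 2) + 1) (2 * (a + t) + 1)" if "t < k" "t \<noteq> k div 2" for t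
  proof (rule coprime_odd_nearby [where D = 2])
    fix p :: nat assume "prime p" "odd p" "p \<le> 2"
    then show "\<not> p dvd 2 * (a + k div 2) + 1"
      using prime_ge_2_nat [of p] by (cases "p = 2") auto
  qed (use that True in auto)
  then show ?thesis
    using assms by (intro exI [of _ "k div 2"]) auto
next
  case False
  \<comment> \<open>The candidates \<open>s\<close>, ..., \<open>s + 4\<close> avoid position 0,
    which is reserved for the path, and stay within distance 10 of both ends \<open>0\<close> and
    \<open>k - 1\<close>; this is where \<open>k \<le> 17\<close> enters.\<close>
  define s where "s = max 1 (k - 11)"
  obtain t where t: "t \<le> 4" "\<not> 3 dvd 2 * (a + s + t) + 1" "\<not> 5 dvd 2 * (a + s + t) + 1"
      "\<not> 7 dvd 2 * (a + s + t) + 1"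
    using exists_coprime_105_in_five [of "a + s"] by blast
  define c where "c = s + t"
  have c: "1 \<le> c" "c < k" "c \<le> 10" "k \<le> c + 11"
    using t(1) False assms by (auto simp: c_def s_def max_def)
  have "coprime (2 * (a + c) + 1) (2 * (a + r) + 1)" if "r < k" "r \<noteq> c" for r
  proof (rule coprime_odd_nearby [where D = 10])
    fix p :: nat assume "prime p" "odd p" "p \<le> 10"
    then have "p \<in> {3, 5, 7}" by (rule odd_prime_le_10)
    then show "\<not> p dvd 2 * (a + c) + 1"
      using t by (auto simp: c_def add.assoc)
  qed (use that c in auto)
  then show ?thesis
    using c by blast
qed

lemma odd_prime_firecracker_small:
  assumes k: "3 \<le> k" "k \<le> 17"
  shows "odd_prime (firecracker_vertices n k) (firecracker_edges n k)"
proof -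
  \<comment> \<open>Blocks are numbered from 1, hence \<open>i - 1\<close>; position 0 of a block
    carries its path label.\<close>
  define b where "b i t = 2 * (k * (i - 1) + t) + 1" for i t :: nat
  have "\<forall>i. \<exists>c. 1 \<le> c \<and> c < k \<and> (\<forall>t<k. t \<noteq> c \<longrightarrow> coprime (b i c) (b i t))"
    unfolding b_def using local_centre [OF k] by blast
  then obtain c where c: "\<And>i. 1 \<le> c i" "\<And>i. c i < k"
      "\<And>i t. t < k \<Longrightarrow> t \<noteq> c i \<Longrightarrow> coprime (b i (c i)) (b i t)"
    by metis
  have "\<exists>h. bij_betw h {1..k - 2} ({1..<k} - {c i})" for i
  proof -
    have "card ({1..<k} - {c i}) = k - 2"
      using c(1,2) [of i] by simp
    then show ?thesis
      by (metis ex_bij_betw_nat_finite_1 finite_Diff finite_atLeastLessThan)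
  qed
  then obtain h where h: "\<And>i. bij_betw (h i) {1..k - 2} ({1..<k} - {c i})"
    by metis
  have leaf: "h i j < k \<and> h i j \<noteq> c i" if "j \<in> {1..k - 2}" for i j
    using bij_betwE [OF h] that by fastforce
  show ?thesis
  proof (rule odd_prime_firecrackerI [where v = "\<lambda>i. b i 0" and u = "\<lambda>i. b i (c i)"
        and w = "\<lambda>i j. b i (h i j)"])
    show "(\<lambda>i. b i 0) ` {1..n} \<union> (\<lambda>i. b i (c i)) ` {1..n}
        \<union> (\<lambda>(i, j). b i (h i j)) ` ({1..n} \<times> {1..k - 2}) = {l. odd l \<and> l < 2 * (n * k)}" (is "?L = ?R")
    proof
      have "b i t \<in> ?R" if "i \<in> {1..n}" "t < k" for i t
      proof -
        have "k * (i - 1) + t < k * (i - 1) + k" using that by simp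
        also have "\<dots> = k * i" using that by (cases i) auto
        also have "\<dots> \<le> n * k" using that by simp
        finally show ?thesis by (simp add: b_def)
      qed
      then show "?L \<subseteq> ?R"
        using c(2) leaf k by auto
    next
      show "?R \<subseteq> ?L"
      proof
        fix l assume l: "l \<in> ?R"
        then obtain m where m: "l = 2 * m + 1" by (auto elim: oddE)
        define i where "i = m div k + 1"
        define t where "t = m mod k"
        have lb: "l = b i t" by (simp add: b_def i_def t_def m)
        have "m < n * k" using l m by simp
        then have i: "i \<in> {1..n}"
          using k by (simp add: i_def less_mult_imp_div_less Suc_le_eq)
        have "t < k" using k by (simp add: t_def)
        then consider "t = 0" | "t = c i" | "t \<in> {1..<k} - {c i}" by fastforce
        then show "l \<in> ?L"
        proof cases
          case 3
          then have "t \<in> h i ` {1..k - 2}"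
            using h [of i] by (simp add: bij_betw_def)
          then show ?thesis using i lb by force
        qed (use i lb in auto)
      qed
    qed
  next
    fix i assume i: "1 \<le> i" "i < n"
    have next_b: "b (i + 1) 0 = b i 0 + 2 * k"
      using i by (cases i) (auto simp: b_def)
    show "coprime (b i 0) (b (i + 1) 0)"
    proof (rule coprimeI)
      fix d assume d: "d dvd b i 0" "d dvd b (i + 1) 0"
      then have "d dvd 2 * k"
        unfolding next_b by (simp add: dvd_add_right_iff)
      then have "d dvd 2 * k * (i - 1)" by (rule dvd_mult2)
      moreover have "b i 0 = 2 * k * (i - 1) + 1" by (simp add: b_def)
      ultimately show "is_unit d"
        using d(1) by (metis dvd_add_right_iff)
    qed
  next
    fix i assume "1 \<le> i" "i \<le> n"
    show "coprime (b i 0) (b i (c i))"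
      using c(3) [of 0 i] c(1) [of i] k by (simp add: coprime_commute)
  next
    fix i j assume "1 \<le> i" "i \<le> n" "1 \<le> j" "j \<le> k - 2"
    then show "coprime (b i (c i)) (b i (h i j))"
      using leaf [of j i] by (intro c(3)) auto
  qed (use k in auto)
qed

section \<open>Bounds of Chebyshev type\<close>

text \<open>These numbers are the denominators of Leibniz's harmonic triangle. Neighbouring entries
  satisfy \<open>1/c = 1/b - 1/a\<close>, so with \<open>D\<close> the lcm,
  \<open>D/c = D/b - D/a\<close> is an integer once \<open>a\<close> and \<open>b\<close> divide
  \<open>D\<close>.\<close>

lemma harmonic_triangle_dvd_Lcm:
  assumes "m \<le> n"
  shows "Suc m * (Suc n choose Suc m) dvd Lcm {1..Suc n}"
  using assms
proof (induction m arbitrary: n)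
  case 0
  show ?case by (auto intro: dvd_Lcm)
next
  case (Suc m)
  then obtain r where n: "n = Suc r" "m \<le> r"
    by (cases n) auto
  let ?D = "Lcm {1..Suc n}"
  define a where "a = Suc m * (Suc n choose Suc m)"
  define b where "b = Suc m * (Suc r choose Suc m)"
  define c where "c = Suc (Suc m) * (Suc n choose Suc (Suc m))"
  have "a dvd ?D"
    unfolding a_def using Suc by simp
  moreover have "b dvd ?D"
  proof -
    have "Lcm {1..Suc r} dvd ?D"
      by (rule Lcm_subset) (auto simp: n)
    then show ?thesis
      using Suc.IH [of r] n unfolding b_def by (meson dvd_trans)
  qed
  ultimately obtain x y where xy: "?D = a * x" "?D = b * y"
    unfolding dvd_def by blast
  have pos: "a > 0" "b > 0"
    using Suc.prems n by (auto simp: a_def b_def)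
  have a: "a = Suc n * (n choose m)" and c: "c = Suc n * (n choose Suc m)"
    unfolding a_def c_def using Suc_times_binomial_eq by (metis mult.commute)+
  have b: "b = Suc m * (n choose Suc m)"
    unfolding b_def n ..
  have b': "b = (n - m) * (n choose m)"
    using binomial_absorb_comp [of n m] Suc_times_binomial_eq [of r m] unfolding b_def
    by (simp add: n mult.commute)
  have "Suc n = (n - m) + Suc m"
    using Suc.prems by simp
  then have "a = b + Suc m * (n choose m)"
    unfolding a b' by (metis add_mult_distrib)
  then have diff: "int a - int b = int (Suc m * (n choose m))"
    by simp
  have "int a * int b = int (Suc n * (n choose m)) * int (Suc m * (n choose Suc m))"
    using a b by metis
  also have "\<dots> = int c * (int a - int b)"
    unfolding diff c of_nat_mult by (simp only: ac_simps)
  \<comment> \<open>This is \<open>1/c = 1/b - 1/a\<close> with the denominators cleared.\<close>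
  finally have rec: "int a * int b = int c * (int a - int b)" .
  have "int a * int b * int ?D = int a * int b * (int c * (int y - int x))"
  proof -
    have "int c * (int a - int b) * int ?D = int c * (int a * int (b * y) - int b * int (a * x))"
      using xy by (simp add: algebra_simps)
    then show ?thesis
      unfolding rec [symmetric] by (simp add: algebra_simps)
  qed
  then have "int ?D = int c * (int y - int x)"
    using pos by simp
  then show ?case
    unfolding c_def by (metis dvd_triv_left int_dvd_int_iff)
qed

text \<open>A middle entry of row \<open>2 * n - 1\<close> of the triangle is
  \<open>n * (2 * n choose n)\<close>, which is at least \<open>4 ^ n / 2\<close>.\<close>

lemma Lcm_ge_4_power:
  assumes "n > 0"
  shows "4 ^ n \<le> 2 * Lcm {1..2 * n}"
proof -
  have "n * (2 * n choose n) dvd Lcm {1..2 * n}"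
    using harmonic_triangle_dvd_Lcm [of "n - 1" "2 * n - 1"] assms by simp
  then have "n * (2 * n choose n) \<le> Lcm {1..2 * n}"
    by (rule dvd_imp_le) (auto intro!: Nat.gr0I simp: Lcm_0_iff)
  moreover have "4 ^ n \<le> 2 * (n * (2 * n choose n))"
  proof -
    have "4 ^ n \<le> real (2 * (n * (2 * n choose n)))"
      using central_binomial_lower_bound [OF assms] assms by (simp add: field_simps)
    then show ?thesis
      by (metis of_nat_le_iff of_nat_numeral of_nat_power)
  qed
  ultimately show ?thesis by linarith
qed

lemma prime_power_dvd_Lcm:
  fixes p :: nat
  assumes "finite A" "0 \<notin> A" "prime p" "p ^ e dvd Lcm A" "e > 0"
  shows "\<exists>a\<in>A. p ^ e dvd a"
  using assms
proof (induction A rule: finite_induct)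
  case empty
  then show ?case by auto
next
  case (insert a A)
  have nz: "a \<noteq> 0" "Lcm A \<noteq> 0"
    using insert by (auto simp: Lcm_0_iff)
  have "p ^ e dvd lcm a (Lcm A)"
    using insert.prems by simp
  then have "e \<le> multiplicity p (lcm a (Lcm A))"
    using nz \<open>prime p\<close> by (subst (asm) power_dvd_iff_le_multiplicity) (auto simp: lcm_eq_0_iff)
  then have "e \<le> multiplicity p a \<or> e \<le> multiplicity p (Lcm A)"
    using nz \<open>prime p\<close> by (simp add: multiplicity_lcm le_max_iff_disj)
  then have "p ^ e dvd a \<or> p ^ e dvd Lcm A"
    by (meson multiplicity_dvd')
  then show ?case using insert by auto
qed

definition prime_count :: "nat \<Rightarrow> nat" where
  "prime_count x = card {p. prime p \<and> p \<le> x}"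

lemma finite_primes_le [simp]: "finite {p::nat. prime p \<and> p \<le> x}"
  by (rule finite_subset [of _ "{..x}"]) auto

text \<open>Each maximal prime power in the lcm already divides one of \<open>1\<close>, ...,
  \<open>m\<close>, so it is at most \<open>m\<close>, and there are at most
  \<open>prime_count m\<close> of them.\<close>

lemma Lcm_le_power_prime_count:
  assumes "m > 0"
  shows "Lcm {1..m} \<le> m ^ prime_count m"
proof -
  let ?D = "Lcm {1..m}"
  have nz: "?D \<noteq> 0" by (auto simp: Lcm_0_iff)
  have le: "p \<le> m \<and> p ^ multiplicity p ?D \<le> m" if "p \<in> prime_factors ?D" for p
  proof -
    have p: "prime p" "multiplicity p ?D > 0"
      using that by (auto simp: prime_factors_multiplicity)
    then obtain a where a: "a \<in> {1..m}" "p ^ multiplicity p ?D dvd a"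
      using prime_power_dvd_Lcm [of "{1..m}" p "multiplicity p ?D"] multiplicity_dvd [of p ?D] by force
    then have "p ^ multiplicity p ?D \<le> m"
      using dvd_imp_le [OF a(2)] by simp
    moreover have "p \<le> p ^ multiplicity p ?D"
      using p prime_ge_1_nat by (intro self_le_power) blast+
    ultimately show ?thesis by linarith
  qed
  have "?D = (\<Prod>p\<in>prime_factors ?D. p ^ multiplicity p ?D)"
    using nz by (simp add: prod_prime_factors)
  also have "\<dots> \<le> (\<Prod>p\<in>prime_factors ?D. m)"
    by (intro prod_mono conjI) (simp, use le in blast)
  also have "\<dots> = m ^ card (prime_factors ?D)"
    by simp
  also have "\<dots> \<le> m ^ prime_count m"
  proof (intro power_increasing)
    have "prime_factors ?D \<subseteq> {p. prime p \<and> p \<le> m}"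
      using le by blast
    then show "card (prime_factors ?D) \<le> prime_count m"
      unfolding prime_count_def by (intro card_mono) auto
  qed (use assms in simp)
  finally show ?thesis .
qed

lemma prime_count_lower:
  assumes "n > 0"
  shows "real n * ln 4 - ln 2 \<le> real (prime_count (2 * n)) * ln (2 * real n)"
proof -
  have "4 ^ n \<le> 2 * (2 * n) ^ prime_count (2 * n)"
    using Lcm_ge_4_power [OF assms] Lcm_le_power_prime_count [of "2 * n"] assms by linarith
  then have "real (4 ^ n) \<le> real (2 * (2 * n) ^ prime_count (2 * n))"
    by (simp only: of_nat_le_iff)
  then have "(4::real) ^ n \<le> 2 * (2 * real n) ^ prime_count (2 * n)"
    by simp
  then have "ln ((4::real) ^ n) \<le> ln (2 * (2 * real n) ^ prime_count (2 * n))"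
    using assms by (subst ln_le_cancel_iff) auto
  then show ?thesis
    using assms by (simp add: ln_mult ln_realpow algebra_simps)
qed

section \<open>Chebyshev's upper bound through the product of the primes\<close>

lemma prod_distinct_primes_dvd:
  fixes n :: nat
  assumes "finite Q" "\<And>p. p \<in> Q \<Longrightarrow> prime p \<and> p dvd n"
  shows "\<Prod>Q dvd n"
  using assms
proof (induction Q rule: finite_induct)
  case (insert p Q)
  have "coprime p (\<Prod>Q)"
    using insert.hyps insert.prems by (intro prod_coprime_right) (metis insertCI primes_coprime)
  then show ?case
    using insert by (simp add: divides_mult)
qed simp

text \<open>Erdos's argument: for \<open>m = 2 * r + 1\<close> the primes above \<open>r + 1\<close>
  divide \<open>2 * r + 1 choose r\<close>, which is at most \<open>4 ^ r\<close>, and induction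
  handles those up to \<open>r + 1\<close>. An even \<open>m > 2\<close> adds no prime.\<close>

lemma prod_primes_le_4_power:
  "\<Prod>{p::nat. prime p \<and> p \<le> m} \<le> 4 ^ m"
proof (induction m rule: less_induct)
  case (less m)
  let ?P = "\<lambda>m. \<Prod>{p::nat. prime p \<and> p \<le> m}"
  consider "m \<le> 1" | "m = 2" | "m > 2" "even m" | "m > 1" "odd m"
    by linarith
  then show ?case
  proof cases
    case 1
    have "\<not> (prime p \<and> p \<le> m)" for p :: nat
      using prime_ge_2_nat [of p] 1 by auto
    then have "{p::nat. prime p \<and> p \<le> m} = {}"
      by blast
    then show ?thesis by (simp only: prod.empty) simp
  next
    case 2
    have "prime p \<and> p \<le> m \<longleftrightarrow> p = 2" for p :: nat
      using prime_ge_2_nat [of p] 2 two_is_prime_nat by (cases "p = 2") (simp, linarith)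
    then have "{p::nat. prime p \<and> p \<le> m} = {2}"
      by blast
    then show ?thesis using 2 by simp
  next
    case 3
    then have "\<not> prime m"
      using prime_odd_nat by blast
    then have "prime p \<and> p \<le> m \<longleftrightarrow> prime p \<and> p \<le> m - 1" for p
      by (cases "p = m") auto
    then have "{p::nat. prime p \<and> p \<le> m} = {p. prime p \<and> p \<le> m - 1}"
      by simp
    moreover have "(4::nat) ^ (m - 1) \<le> 4 ^ m"
      by (intro power_increasing) auto
    ultimately show ?thesis
      using less.IH [of "m - 1"] 3 by (metis diff_less less_imp_le_nat le_trans zero_less_one less_trans zero_less_numeral)
  next
    case 4
    then obtain r where "m = 2 * r + 1"
      by (metis oddE)
    with 4 have r: "m = 2 * r + 1" "r > 0"
      by auto
    define Q where "Q = {p::nat. prime p \<and> r + 1 < p \<and> p \<le> 2 * r + 1}"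
    have fin: "finite Q"
      by (rule finite_subset [of _ "{..m}"]) (auto simp: Q_def r)
    have "p dvd (2 * r + 1 choose r)" if "p \<in> Q" for p
    proof -
      have "p dvd fact (2 * r + 1)" "\<not> p dvd fact r" "\<not> p dvd fact (r + 1)"
        using that by (auto simp: Q_def prime_dvd_fact_iff simp del: fact_Suc)
      moreover have "fact r * fact (r + 1) * (2 * r + 1 choose r) = (fact (2 * r + 1) :: nat)"
        using binomial_fact_lemma [of r "2 * r + 1"] by (simp del: fact_Suc)
      ultimately show ?thesis
        using that by (metis (no_types, lifting) Q_def mem_Collect_eq prime_dvd_mult_iff)
    qed
    then have "\<Prod>Q dvd (2 * r + 1 choose r)"
      using fin by (intro prod_distinct_primes_dvd) (auto simp: Q_def)
    then have "\<Prod>Q \<le> (2 * r + 1 choose r)"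
      by (rule dvd_imp_le) simp
    also have "\<dots> \<le> 4 ^ r"
    proof -
      \<comment> \<open>The two middle coefficients are equal, and together they are at most the row
        sum \<open>2 ^ (2 * r + 1)\<close>.\<close>
      have "(2 * r + 1 choose r) + (2 * r + 1 choose (r + 1)) = (\<Sum>k\<in>{r, r + 1}. 2 * r + 1 choose k)"
        by simp
      also have "\<dots> \<le> (\<Sum>k\<le>2 * r + 1. 2 * r + 1 choose k)"
        by (rule sum_mono2) auto
      also have "\<dots> = 2 * 4 ^ r"
        by (simp only: choose_row_sum) (simp add: power_mult)
      finally show ?thesis
        using binomial_symmetric [of r "2 * r + 1"] by simp
    qed
    finally have Q: "\<Prod>Q \<le> 4 ^ r" .
    have "{p. prime p \<and> p \<le> m} = {p. prime p \<and> p \<le> r + 1} \<union> Q"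
      by (auto simp: Q_def r)
    then have "?P m = ?P (r + 1) * \<Prod>Q"
      using fin by (simp add: prod.union_disjoint Q_def disjoint_iff)
    also have "\<dots> \<le> 4 ^ (r + 1) * 4 ^ r"
      using less.IH [of "r + 1"] Q r by (intro mult_mono) auto
    also have "\<dots> = 4 ^ m"
      by (simp add: r flip: power_add)
    finally show ?thesis .
  qed
qed

text \<open>The primes up to \<open>sqrt z\<close> are counted trivially. Each of the others exceeds
  \<open>sqrt z\<close> while their product is at most \<open>4 ^ z\<close>, which bounds their
  number; \<open>ln (sqrt z) = ln z / 2\<close> causes the factor 2.\<close>

lemma prime_count_upper:
  assumes "z > 1"
  shows "real (prime_count z) * ln (real z) \<le> sqrt (real z) * ln (real z) + 2 * real z * ln 4"
proof -
  define s where "s = nat \<lfloor>sqrt (real z)\<rfloor>"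
  define Q where "Q = {p. prime p \<and> s < p \<and> p \<le> z}"
  have fin: "finite Q"
    by (rule finite_subset [of _ "{..z}"]) (auto simp: Q_def)
  have "prime_count z \<le> card ({1..s} \<union> Q)"
    unfolding prime_count_def using fin
    by (intro card_mono) (auto simp: Q_def prime_ge_1_nat Suc_le_eq prime_gt_0_nat)
  also have "\<dots> \<le> s + card Q"
    by (metis card_Un_le card_atLeastAtMost diff_Suc_1)
  finally have "prime_count z \<le> s + card Q" .
  have 1: "real (prime_count z) \<le> sqrt (real z) + real (card Q)"
  proof -
    have "real s \<le> sqrt (real z)"
      by (simp add: s_def of_nat_floor)
    moreover have "real (prime_count z) \<le> real s + real (card Q)"
      using \<open>prime_count z \<le> s + card Q\<close> by (simp flip: of_nat_add)
    ultimately show ?thesis by linarith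
  qed
  have "(\<Prod>p\<in>Q. sqrt (real z)) \<le> (\<Prod>p\<in>Q. real p)"
  proof (intro prod_mono conjI)
    fix p assume "p \<in> Q"
    then have "\<lfloor>sqrt (real z)\<rfloor> < int p"
      unfolding Q_def s_def by auto
    then show "sqrt (real z) \<le> real p" by linarith
  qed simp
  also have "(\<Prod>p\<in>Q. real p) = real (\<Prod>Q)" by simp
  also have "\<dots> \<le> real (\<Prod>{p. prime p \<and> p \<le> z})"
    unfolding of_nat_le_iff
    by (rule dvd_imp_le) (auto intro!: prod_dvd_prod_subset prod_pos simp: Q_def prime_gt_0_nat)
  also have "\<dots> \<le> 4 ^ z"
    using prod_primes_le_4_power [of z] by (metis of_nat_le_iff of_nat_numeral of_nat_power)
  finally have "sqrt (real z) ^ card Q \<le> 4 ^ z" by simp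
  then have "ln (sqrt (real z) ^ card Q) \<le> ln (4 ^ z)"
    using assms by (subst ln_le_cancel_iff) auto
  then have "real (card Q) * ln (real z) \<le> 2 * real z * ln 4"
    using assms by (simp add: ln_realpow ln_sqrt)
  then show ?thesis
    using mult_right_mono [OF 1, of "ln (real z)"] assms by (simp add: algebra_simps)
qed

section \<open>Odd numbers without small prime factors\<close>

lemma card_coprime_less:
  assumes "M > 0"
  shows "card {x. x < M \<and> coprime x M} = totient M"
proof (cases "M = 1")
  \<comment> \<open>\<open>totatives M\<close> ranges over \<open>1\<close>, ..., \<open>M\<close>
    instead of \<open>0\<close>, ..., \<open>M - 1\<close>; the differing endpoints are coprime to
    \<open>M\<close> only here.\<close>
  case True
  then show ?thesis by simp
next
  case False
  have "{x. x < M \<and> coprime x M} = totatives M"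
    using assms False by (auto simp: totatives_def intro!: Nat.gr0I le_neq_implies_less)
  then show ?thesis by (simp add: totient_def)
qed

text \<open>As \<open>M\<close> is odd, \<open>2 * i + 1\<close> runs through every residue class
  modulo \<open>M\<close> exactly once when \<open>i\<close> runs through \<open>M\<close>
  consecutive values.\<close>

lemma card_coprime_odd_period:
  assumes "odd M"
  shows "card {i \<in> {a..<a + M}. coprime (2 * i + 1) M} = totient M"
proof -
  have M: "M > 0" using assms by (auto intro: Nat.gr0I)
  define f where "f i = (2 * i + 1) mod M" for i
  have inj: "inj_on f {a..<a + M}"
  proof (rule linorder_inj_onI)
    fix i j assume ij: "i < j" "i \<in> {a..<a + M}" "j \<in> {a..<a + M}"
    show "f i \<noteq> f j"
    proof
      assume "f i = f j"
      then have "M dvd (2 * j + 1) - (2 * i + 1)"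
        using ij by (intro mod_eq_dvd_iff_nat [THEN iffD1]) (auto simp: f_def)
      then have "M dvd 2 * (j - i)"
        by (simp add: diff_mult_distrib2)
      then have "M dvd j - i"
        using assms by (simp add: coprime_dvd_mult_right_iff)
      then show False
        using ij by (auto dest: dvd_imp_le)
    qed
  qed auto
  have "card (f ` {a..<a + M}) = M"
    using card_image [OF inj] by simp
  moreover have "f ` {a..<a + M} \<subseteq> {..<M}"
    using M by (auto simp: f_def)
  ultimately have "f ` {a..<a + M} = {..<M}"
    by (intro card_subset_eq) auto
  moreover have cop: "coprime (f i) M \<longleftrightarrow> coprime (2 * i + 1) M" for i
    unfolding f_def using M by (simp add: coprime_mod_left_iff)
  moreover have "f ` {i \<in> {a..<a + M}. coprime (f i) M} = {x \<in> f ` {a..<a + M}. coprime x M}"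
    by blast
  ultimately have "f ` {i \<in> {a..<a + M}. coprime (2 * i + 1) M} = {x. x < M \<and> coprime x M}"
    unfolding cop by simp
  moreover have "card (f ` {i \<in> {a..<a + M}. coprime (2 * i + 1) M})
      = card {i \<in> {a..<a + M}. coprime (2 * i + 1) M}"
    by (intro card_image inj_on_subset [OF inj]) auto
  ultimately show ?thesis
    using card_coprime_less [OF M] by simp
qed

lemma card_coprime_odd_periods:
  assumes "odd M"
  shows "card {i \<in> {a..<a + q * M}. coprime (2 * i + 1) M} = totient M * q"
proof (induction q)
  case (Suc q)
  let ?A = "\<lambda>x y. {i \<in> {x..<y}. coprime (2 * i + 1) M}"
  have split: "?A x (y + z) = ?A x y \<union> ?A y (y + z)" if "x \<le> y" for x y z
    using that by auto
  have "card (?A x (y + z)) = card (?A x y) + card (?A y (y + z))" if "x \<le> y" for x y z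
    unfolding split [OF that] by (intro card_Un_disjoint) auto
  from this [of a "a + q * M" M] show ?case
    using Suc.IH card_coprime_odd_period [OF assms, of "a + q * M"] by (simp add: algebra_simps)
qed simp

text \<open>The interval lies between \<open>m div M\<close> and \<open>m div M + 1\<close> whole
  periods.\<close>

lemma card_coprime_odd_bounds:
  assumes "odd M"
  shows "totient M * (m div M) \<le> card {i \<in> {a..<a + m}. coprime (2 * i + 1) M}"
    and "card {i \<in> {a..<a + m}. coprime (2 * i + 1) M} \<le> totient M * (m div M + 1)"
proof -
  have M: "M > 0" using assms by (auto intro: Nat.gr0I)
  let ?A = "\<lambda>y. {i \<in> {a..<a + y}. coprime (2 * i + 1) M}"
  have mono: "card (?A x) \<le> card (?A y)" if "x \<le> y" for x y
    using that by (intro card_mono) auto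
  have "card (?A (m div M * M)) \<le> card (?A m)"
    by (intro mono) simp
  moreover have "card (?A m) \<le> card (?A ((m div M + 1) * M))"
    using dividend_less_div_times [OF M, of m] by (intro mono) simp
  ultimately show "totient M * (m div M) \<le> card (?A m)" "card (?A m) \<le> totient M * (m div M + 1)"
    unfolding card_coprime_odd_periods [OF assms] by auto
qed

text \<open>The bound is \<open>2 * d\<close> so that raising \<open>d\<close> by one brings in a
  single new odd candidate, \<open>2 * d + 1\<close>.\<close>

definition odd_primorial :: "nat \<Rightarrow> nat" where
  "odd_primorial d = \<Prod>{p. prime p \<and> 2 < p \<and> p \<le> 2 * d}"

lemma finite_odd_primes_le [simp]: "finite {p::nat. prime p \<and> 2 < p \<and> p \<le> m}"
  by (rule finite_subset [of _ "{..m}"]) auto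

lemma odd_odd_primorial: "odd (odd_primorial d)"
proof -
  have "\<not> 2 dvd p" if "prime p" "2 < p" for p :: nat
    using prime_odd_nat [OF that] by simp
  then show ?thesis
    unfolding odd_primorial_def by (subst prime_dvd_prod_iff) auto
qed

lemma odd_primorial_pos: "odd_primorial d > 0"
  using odd_odd_primorial [of d] by (auto intro: Nat.gr0I)

lemma odd_primorial_le: "odd_primorial d \<le> 4 ^ (2 * d)"
proof -
  have "odd_primorial d dvd \<Prod>{p. prime p \<and> p \<le> 2 * d}"
    unfolding odd_primorial_def by (intro prod_dvd_prod_subset) auto
  then have "odd_primorial d \<le> \<Prod>{p. prime p \<and> p \<le> 2 * d}"
    by (rule dvd_imp_le) (auto intro!: prod_pos prime_gt_0_nat)
  then show ?thesis
    using prod_primes_le_4_power order_trans by blast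
qed

lemma odd_primes_Suc:
  assumes "d > 0"
  shows "{p::nat. prime p \<and> 2 < p \<and> p \<le> 2 * Suc d}
    = {p. prime p \<and> 2 < p \<and> p \<le> 2 * d} \<union> (if prime (2 * d + 1) then {2 * d + 1} else {})"
proof -
  have "p \<le> 2 * Suc d \<longleftrightarrow> p \<le> 2 * d \<or> p = 2 * d + 1" if "prime p" "2 < p" for p
    using prime_odd_nat [OF that] by presburger
  then show ?thesis using assms by auto
qed

text \<open>Comparing with all odd numbers below \<open>2 d\<close>,
  \<open>\<Prod>(1 - 1/p) \<ge> \<Prod>(1 - 1/(2 i + 1)) \<ge> \<Prod> i/(i + 1) = 1/d\<close>.\<close>
lemma odd_primorial_le_totient:
  assumes "d > 0"
  shows "odd_primorial d \<le> d * totient (odd_primorial d)"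
proof -
  let ?S = "\<lambda>d. {p::nat. prime p \<and> 2 < p \<and> p \<le> 2 * d}"
  have tot: "totient (odd_primorial d) = (\<Prod>p\<in>?S d. p - 1)"
  proof -
    have "totient (\<Prod>p\<in>?S d. p) = (\<Prod>p\<in>?S d. totient p)"
      by (rule totient_prod_coprime) (auto simp: pairwise_def primes_coprime)
    then show ?thesis
      by (simp add: odd_primorial_def totient_prime)
  qed
  have "(\<Prod>p\<in>?S d. p) \<le> d * (\<Prod>p\<in>?S d. p - 1)"
    using assms
  proof (induction d rule: nat_induct_non_zero)
    case 1
    have "?S 1 = {}" by auto
    then show ?case by (simp only: prod.empty)
  next
    case (Suc d)
    show ?case
    proof (cases "prime (2 * d + 1)")
      case True
      then have S: "?S (Suc d) = insert (2 * d + 1) (?S d)"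
        using odd_primes_Suc [OF Suc.hyps] by simp
      let ?f = "\<Prod>p\<in>?S d. p - 1"
      have "(\<Prod>p\<in>?S (Suc d). p) = (2 * d + 1) * (\<Prod>p\<in>?S d. p)"
        unfolding S by (subst prod.insert) auto
      also have "\<dots> \<le> (2 * d + 1) * (d * ?f)"
        using Suc.IH by (intro mult_left_mono) auto
      also have "\<dots> \<le> Suc d * (2 * d * ?f)"
        by (simp add: algebra_simps)
      also have "2 * d * ?f = (\<Prod>p\<in>?S (Suc d). p - 1)"
        unfolding S by (subst prod.insert) auto
      finally show ?thesis .
    next
      case False
      then have "?S (Suc d) = ?S d"
        using odd_primes_Suc [OF Suc.hyps] by simp
      then show ?thesis
        using Suc.IH by simp
    qed
  qed
  then show ?thesis
    by (simp add: tot) (simp add: odd_primorial_def)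
qed

section \<open>Sums of reciprocals and the sieve\<close>

lemma sum_inverse_le_ln:
  assumes "m \<ge> 1"
  shows "(\<Sum>i=2..m. 1 / real i) \<le> ln (real m)"
  using assms
proof (induction m rule: dec_induct)
  case (step m)
  \<comment> \<open>\<open>ln x \<le> x - 1\<close> at \<open>x = m / (m + 1)\<close> bounds each
    term by a difference of logarithms.\<close>
  have "ln (real m / real (Suc m)) \<le> real m / real (Suc m) - 1"
    using step.hyps by (intro ln_le_minus_one) auto
  also have "\<dots> = - (1 / real (Suc m))"
    by (simp add: field_simps)
  finally have "1 / real (Suc m) \<le> ln (real (Suc m)) - ln (real m)"
    using step.hyps by (simp add: ln_div)
  then show ?case
    using step by (simp add: sum.cl_ivl_Suc)
qed simp

text \<open>Telescoping: as \<open>(2 * x + 1)^2 \<ge> 4 * x * (x + 1)\<close>, each term is at most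
  a quarter of \<open>1/x - 1/(x + 1)\<close>.\<close>

lemma sum_inverse_odd_squares:
  assumes "d \<ge> 1"
  shows "(\<Sum>i\<in>{d..<d + r}. 1 / (2 * real i + 1)\<^sup>2) \<le> 1 / (4 * real d) - 1 / (4 * real (d + r))"
proof (induction r)
  case (Suc r)
  define x where "x = real (d + r)"
  have "x > 0" using assms by (simp add: x_def)
  have "(2 * x + 1)\<^sup>2 \<ge> 4 * (x * (x + 1))"
    by (simp add: power2_eq_square algebra_simps)
  then have "1 / (2 * x + 1)\<^sup>2 \<le> 1 / (4 * (x * (x + 1)))"
    using \<open>x > 0\<close> by (intro divide_left_mono) (auto intro: add_pos_pos)
  also have "\<dots> = 1 / (4 * x) - 1 / (4 * (x + 1))"
    using \<open>x > 0\<close> by (simp add: field_simps)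
  finally show ?case
    using Suc.IH by (simp add: x_def algebra_simps)
qed simp

text \<open>By a union bound over primes, this bounds the share of the numbers in any
  \<open>{1..X}\<close> that are not coprime to \<open>l > 0\<close>.\<close>

definition prime_weight :: "nat \<Rightarrow> real" where
  "prime_weight l = (\<Sum>p\<in>prime_factors l. 1 / real p)"

text \<open>The numbers coprime to \<open>M\<close> are counted by periods; among them, the first moment of
  \<open>prime_weight\<close> is small, so Markov's inequality leaves most of them with weight at most \<open>\<delta>\<close>.\<close>
lemma sieve_lower_bound:
  fixes \<delta> :: real
  assumes d: "d \<ge> 1" and \<delta>: "\<delta> > 0" and nN: "n + 1 \<le> N"
  defines "M \<equiv> odd_primorial d"
  shows "real (totient M) / real M *
           (real N - real n - 1 - real M - (real N / (4 * real d) + 2 * real M * ln (2 * real N)) / \<delta>)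
         \<le> real (card {i \<in> {n + 1..<N}. prime_weight (2 * i + 1) \<le> \<delta>})"
proof -
  have M: "odd M" "M > 0"
    by (auto simp: M_def odd_odd_primorial odd_primorial_pos)
  \<comment> \<open>Odd numbers are handled through their index \<open>i\<close>: \<open>R\<close>
    holds those beyond the path labels without primes up to \<open>2 * d\<close>, and
    \<open>P\<close> holds the primes that can still divide them.\<close>
  define R where "R = {i \<in> {n + 1..<N}. coprime (2 * i + 1) M}"
  define P where "P = {p. prime p \<and> 2 * d < p \<and> p < 2 * N}"
  have finP: "finite P" and finR: "finite R"
    unfolding P_def R_def by (auto intro: finite_subset [of _ "{..2 * N}"])
  let ?\<phi> = "real (totient M)"
  have card_R: "?\<phi> * ((real N - real n - 1) / real M - 1) \<le> real (card R)"
  proof -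
    have "totient M * ((N - (n + 1)) div M) \<le> card R"
      using card_coprime_odd_bounds(1) [OF M(1), of "N - (n + 1)" "n + 1"] nN by (simp add: R_def)
    then have "?\<phi> * real ((N - (n + 1)) div M) \<le> real (card R)"
      by (metis of_nat_le_iff of_nat_mult)
    moreover have "real (N - (n + 1)) / real M - 1 \<le> real ((N - (n + 1)) div M)"
      using dividend_less_div_times [OF M(2), of "N - (n + 1)"] M(2)
      by (simp add: field_simps flip: of_nat_add of_nat_mult)
    moreover have "real (N - (n + 1)) = real N - real n - 1"
      using nN by (simp add: of_nat_diff)
    ultimately have "(real N - real n - 1) / real M - 1 \<le> real ((N - (n + 1)) div M)"
      by (simp only:)
    then have "?\<phi> * ((real N - real n - 1) / real M - 1) \<le> ?\<phi> * real ((N - (n + 1)) div M)"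
      by (rule mult_left_mono) simp
    with \<open>?\<phi> * real ((N - (n + 1)) div M) \<le> real (card R)\<close> show ?thesis
      by linarith
  qed
  have mult_card: "real (card {i \<in> R. p dvd 2 * i + 1}) \<le> ?\<phi> * (real N / (real p * real M) + 2)"
    if "p \<in> P" for p
  proof -
    have p: "odd p" "p > 0"
      using that d prime_odd_nat [of p] by (auto simp: P_def)
    \<comment> \<open>A multiple \<open>2 * i + 1 = p * (2 * j + 1)\<close> is determined by its odd
      cofactor, again coprime to \<open>M\<close>. There are \<open>b\<close> odd numbers up to
      \<open>2 * N div p\<close>, so the count by periods applies a second time.\<close>
    define b where "b = (2 * N div p + 1) div 2"
    have "{i \<in> R. p dvd 2 * i + 1} \<subseteq> (\<lambda>j. (p * (2 * j + 1)) div 2) ` {j \<in> {0..<0 + b}. coprime (2 * j + 1) M}"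
    proof
      fix i assume "i \<in> {i \<in> R. p dvd 2 * i + 1}"
      then obtain m where i: "i < N" "coprime (2 * i + 1) M" "2 * i + 1 = p * m"
        by (auto simp: R_def elim!: dvdE)
      then have "odd (p * m)" by (metis even_plus_one_iff dvd_triv_left)
      then obtain j where j: "m = 2 * j + 1" by (metis even_mult_iff oddE)
      have "m * p \<le> 2 * N" using i by (simp add: mult.commute)
      then have "m \<le> 2 * N div p" using p by (simp add: less_eq_div_iff_mult_less_eq)
      then have "j < b" unfolding b_def j by linarith
      moreover have "coprime (2 * j + 1) M"
        using i(2) unfolding i(3) j by (simp only: coprime_mult_left_iff)
      moreover have "i = (p * (2 * j + 1)) div 2"
        unfolding j [symmetric] i(3) [symmetric] by simp
      ultimately show "i \<in> (\<lambda>j. (p * (2 * j + 1)) div 2) ` {j \<in> {0..<0 + b}. coprime (2 * j + 1) M}"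
        by auto
    qed
    then have "card {i \<in> R. p dvd 2 * i + 1} \<le> card {j \<in> {0..<0 + b}. coprime (2 * j + 1) M}"
      by (intro surj_card_le) auto
    also have "\<dots> \<le> totient M * (b div M + 1)"
      by (rule card_coprime_odd_bounds(2) [OF M(1)])
    finally have "real (card {i \<in> R. p dvd 2 * i + 1}) \<le> real (totient M * (b div M + 1))"
      by (rule of_nat_mono)
    also have "\<dots> = ?\<phi> * (real (b div M) + 1)"
      by (simp add: distrib_left)
    also have "\<dots> \<le> ?\<phi> * (real N / (real p * real M) + 2)"
    proof (rule mult_left_mono)
      have "real b \<le> (real (2 * N div p) + 1) / 2"
        using of_nat_div_le_of_nat [of "2 * N div p + 1" 2] by (simp add: b_def)
      moreover have "real (2 * N div p) \<le> 2 * (real N / real p)"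
        using of_nat_div_le_of_nat [of "2 * N" p] by simp
      ultimately have b: "real b \<le> real N / real p + 1"
        by simp
      have "real (b div M) \<le> real b / real M"
        by (rule of_nat_div_le_of_nat)
      also have "\<dots> \<le> (real N / real p + 1) / real M"
        using b by (rule divide_right_mono) simp
      also have "\<dots> \<le> real N / (real p * real M) + 1"
        using M by (simp add: add_divide_distrib divide_le_eq_1 Suc_le_eq)
      finally show "real (b div M) + 1 \<le> real N / (real p * real M) + 2" by simp
    qed simp
    finally show ?thesis .
  qed
  have sq: "(\<Sum>p\<in>P. 1 / (real p)\<^sup>2) \<le> 1 / (4 * real d)"
  proof -
    have "P \<subseteq> (\<lambda>i. 2 * i + 1) ` {d..<d + N}"
    proof
      fix p assume p: "p \<in> P"
      then have "odd p" using d prime_odd_nat [of p] by (auto simp: P_def)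
      then obtain i where "p = 2 * i + 1" by (metis oddE)
      then show "p \<in> (\<lambda>i. 2 * i + 1) ` {d..<d + N}"
        using p by (auto simp: P_def)
    qed
    then have "(\<Sum>p\<in>P. 1 / (real p)\<^sup>2) \<le> (\<Sum>p\<in>(\<lambda>i. 2 * i + 1) ` {d..<d + N}. 1 / (real p)\<^sup>2)"
      by (intro sum_mono2) auto
    also have "\<dots> = (\<Sum>i\<in>{d..<d + N}. 1 / (2 * real i + 1)\<^sup>2)"
      by (subst sum.reindex) (auto simp: inj_on_def add.commute)
    also have "\<dots> \<le> 1 / (4 * real d)"
      using sum_inverse_odd_squares [OF d, of N] by (rule order_trans) simp
    finally show ?thesis .
  qed
  have harm: "(\<Sum>p\<in>P. 1 / real p) \<le> ln (2 * real N)"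
  proof -
    have "(\<Sum>p\<in>P. 1 / real p) \<le> (\<Sum>p\<in>{2..2 * N}. 1 / real p)"
      using d by (intro sum_mono2) (auto simp: P_def)
    also have "\<dots> \<le> ln (2 * real N)"
      using sum_inverse_le_ln [of "2 * N"] nN by simp
    finally show ?thesis .
  qed
  \<comment> \<open>First moment: exchanging the sums leads to the counts \<open>mult_card\<close>.
    Their main terms produce the sum of \<open>1/p^2\<close> over \<open>p > 2 * d\<close>, and the
    rounding errors only a harmonic sum.\<close>
  have "(\<Sum>i\<in>R. prime_weight (2 * i + 1)) = (\<Sum>i\<in>R. \<Sum>p\<in>{p\<in>P. p dvd 2 * i + 1}. 1 / real p)"
  proof (rule sum.cong [OF refl])
    fix i assume i: "i \<in> R"
    have "p > 2 * d" if "prime p" "p dvd 2 * i + 1" for p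
    proof (rule ccontr)
      assume "\<not> p > 2 * d"
      moreover have "p \<noteq> 2" using that by auto
      ultimately have "p \<in> {p. prime p \<and> 2 < p \<and> p \<le> 2 * d}"
        using prime_ge_2_nat [OF that(1)] that(1) by simp
      then have "p dvd M"
        using dvd_prodI [OF finite_odd_primes_le, of p "2 * d" "\<lambda>x. x"]
        by (simp add: M_def odd_primorial_def)
      then show False
        using that i coprime_common_divisor_nat [of "2 * i + 1" M p] by (auto simp: R_def)
    qed
    moreover have "p < 2 * N" if "p dvd 2 * i + 1" for p
      using dvd_imp_le [OF that] i by (auto simp: R_def)
    ultimately have "prime_factors (2 * i + 1) = {p\<in>P. p dvd 2 * i + 1}"
      by (auto simp: P_def in_prime_factors_iff)
    then show "prime_weight (2 * i + 1) = (\<Sum>p\<in>{p\<in>P. p dvd 2 * i + 1}. 1 / real p)"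
      by (simp only: prime_weight_def)
  qed
  also have "\<dots> = (\<Sum>p\<in>P. \<Sum>i\<in>{i\<in>R. p dvd 2 * i + 1}. 1 / real p)"
    by (rule sum.swap_restrict [OF finR finP])
  also have "\<dots> = (\<Sum>p\<in>P. real (card {i \<in> R. p dvd 2 * i + 1}) * (1 / real p))"
    by simp
  also have "\<dots> \<le> (\<Sum>p\<in>P. ?\<phi> * (real N / (real p * real M) + 2) * (1 / real p))"
    using mult_card by (intro sum_mono mult_right_mono) auto
  also have "\<dots> = (\<Sum>p\<in>P. ?\<phi> * (real N / real M * (1 / (real p)\<^sup>2) + 2 * (1 / real p)))"
    by (intro sum.cong refl) (simp add: power2_eq_square distrib_left add_divide_distrib ac_simps)
  also have "\<dots> = ?\<phi> * (real N / real M * (\<Sum>p\<in>P. 1 / (real p)\<^sup>2) + 2 * (\<Sum>p\<in>P. 1 / real p))"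
    by (simp only: sum_distrib_left sum.distrib [symmetric])
  also have "\<dots> \<le> ?\<phi> * (real N / real M * (1 / (4 * real d)) + 2 * ln (2 * real N))"
    using sq harm by (intro mult_left_mono add_mono) auto
  finally have moment: "(\<Sum>i\<in>R. prime_weight (2 * i + 1))
      \<le> ?\<phi> * (real N / real M * (1 / (4 * real d)) + 2 * ln (2 * real N))" .
  let ?B = "{i \<in> R. \<delta> < prime_weight (2 * i + 1)}"
  let ?G = "{i \<in> R. prime_weight (2 * i + 1) \<le> \<delta>}"
  \<comment> \<open>Markov: every index in \<open>?B\<close> contributes more than
    \<open>\<delta>\<close> to the first moment.\<close>
  have "real (card ?B) * \<delta> = (\<Sum>i\<in>?B. \<delta>)"
    by simp
  also have "\<dots> \<le> (\<Sum>i\<in>?B. prime_weight (2 * i + 1))"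
    by (intro sum_mono) auto
  also have "\<dots> \<le> (\<Sum>i\<in>R. prime_weight (2 * i + 1))"
    using finR by (intro sum_mono2) (auto simp: prime_weight_def intro!: sum_nonneg)
  finally have "real (card ?B) * \<delta>
      \<le> ?\<phi> * (real N / real M * (1 / (4 * real d)) + 2 * ln (2 * real N))"
    using moment by linarith
  then have B: "real (card ?B)
      \<le> ?\<phi> * (real N / real M * (1 / (4 * real d)) + 2 * ln (2 * real N)) / \<delta>"
    using \<delta> by (simp add: pos_le_divide_eq)
  have "card (?G \<union> ?B) = card ?G + card ?B"
    using finR by (intro card_Un_disjoint) auto
  moreover have "?G \<union> ?B = R" by auto
  ultimately have "card R = card ?G + card ?B" by simp
  moreover have "card ?G \<le> card {i \<in> {n + 1..<N}. prime_weight (2 * i + 1) \<le> \<delta>}"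
    by (intro card_mono) (auto simp: R_def)
  moreover have "?\<phi> / real M *
        (real N - real n - 1 - real M - (real N / (4 * real d) + 2 * real M * ln (2 * real N)) / \<delta>)
      = ?\<phi> * ((real N - real n - 1) / real M - 1)
        - ?\<phi> * (real N / real M * (1 / (4 * real d)) + 2 * ln (2 * real N)) / \<delta>"
    using M \<delta> d by (simp add: field_simps)
  ultimately show ?thesis
    using card_R B by linarith
qed

section \<open>Numerical estimates\<close>

lemma ln_4_eq: "ln 4 = 2 * ln (2::real)"
  using ln_realpow [of 2 2] by simp

lemma ln_4_less: "ln 4 < (7/5 :: real)"
proof -
  have "ln 2 < (7/10 :: real)"
  proof -
    \<comment> \<open>The quadratic Taylor bound is too weak at \<open>7/10\<close>, so it is taken
      at a quarter of this and raised to the fourth power.\<close>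
    have "(1 + 7/40 + (7/40)\<^sup>2 / 2) ^ 4 \<le> exp (7/40 :: real) ^ 4"
      by (intro power_mono exp_lower_Taylor_quadratic) auto
    also have "\<dots> = exp (7/10)"
      by (simp flip: exp_of_nat_mult)
    finally have "2 < exp (7/10 :: real)"
      by (rule less_le_trans [rotated]) (simp add: eval_nat_numeral)
    then show ?thesis using ln_less_cancel_iff [of 2 "exp (7/10)"] by simp
  qed
  then show ?thesis by (simp add: ln_4_eq)
qed

lemma ln_2_ge: "(2/3 :: real) \<le> ln 2"
proof -
  have "exp (1/12) ^ 8 \<le> (1 + 1/12 + (1/12)\<^sup>2 :: real) ^ 8"
    by (intro power_mono exp_bound) auto
  moreover have "exp (1/12) ^ 8 = exp (2/3 :: real)"
    by (simp flip: exp_of_nat_mult)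
  moreover have "(1 + 1/12 + (1/12)\<^sup>2 :: real) ^ 8 \<le> 2"
    by (simp add: eval_nat_numeral)
  ultimately have "exp (2/3) \<le> (2::real)"
    by linarith
  then show ?thesis
    using ln_le_cancel_iff [of "exp (2/3)" 2] by simp
qed

lemma exp_half_ge: "(13/8 :: real) \<le> exp (1/2)"
  using exp_lower_Taylor_quadratic [of "1/2"] by (simp add: power2_eq_square)

text \<open>With \<open>t = ln x\<close>,
  \<open>sqrt x = exp 6 * exp (t / 2 - 6) \<ge> 300 * (t / 2 - 5)\<close>, which exceeds
  \<open>10 * t\<close> for \<open>t > 12\<close>.\<close>

lemma ln_le_sqrt:
  fixes x :: real
  assumes "x > 0" "ln x > 12"
  shows "ln x \<le> sqrt x / 10"
proof -
  have "(13/8 :: real) ^ 12 \<le> exp (1/2) ^ 12"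
    using exp_half_ge by (intro power_mono) auto
  also have "\<dots> = exp 6"
    by (simp flip: exp_of_nat_mult)
  finally have 1: "300 \<le> exp (6::real)"
    by (rule order_trans [rotated]) (simp add: eval_nat_numeral)
  have 2: "1 + (ln x / 2 - 6) \<le> exp (ln x / 2 - 6)"
    by (rule exp_ge_add_one_self)
  have "10 * ln x \<le> 300 * (1 + (ln x / 2 - 6))"
    using assms by simp
  also have "\<dots> \<le> exp 6 * exp (ln x / 2 - 6)"
    using 1 2 assms by (intro mult_mono) auto
  also have "\<dots> = exp (ln x / 2)"
    by (simp flip: exp_add)
  also have "\<dots> = sqrt x"
  proof -
    have "exp (ln (sqrt x)) = sqrt x"
      using assms by (subst exp_ln) auto
    then show ?thesis
      using assms by (simp add: ln_sqrt)
  qed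
  finally show ?thesis by simp
qed

section \<open>Primes beyond the path labels\<close>

lemma prime_count_odd_le: "prime_count (2 * n + 1) \<le> n + 1"
proof -
  have "{p. prime p \<and> p \<le> 2 * n + 1} \<subseteq> insert 2 ((\<lambda>i. 2 * i + 1) ` {1..n})"
  proof
    fix p assume p: "p \<in> {p. prime p \<and> p \<le> 2 * n + 1}"
    show "p \<in> insert 2 ((\<lambda>i. 2 * i + 1) ` {1..n})"
    proof (cases "p = 2")
      case False
      then have "odd p"
        using p prime_ge_2_nat [of p] prime_odd_nat [of p] by simp
      then obtain i where "p = 2 * i + 1" by (metis oddE)
      then show ?thesis
        using p prime_ge_2_nat [of p] by auto
    qed simp
  qed
  then have "prime_count (2 * n + 1) \<le> card (insert 2 ((\<lambda>i. 2 * i + 1) ` {1..n}))"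
    unfolding prime_count_def by (intro card_mono) auto
  also have "\<dots> \<le> Suc (card ((\<lambda>i. 2 * i + 1) ` {1..n}))"
    by (rule card_insert_le_m1) auto
  also have "\<dots> \<le> n + 1"
    using card_image_le [of "{1..n}" "\<lambda>i. 2 * i + 1"] by simp
  finally show ?thesis .
qed

lemma prime_count_mono: "x \<le> y \<Longrightarrow> prime_count x \<le> prime_count y"
  unfolding prime_count_def by (intro card_mono) auto

lemma card_primes_between:
  assumes "2 * n + 1 \<le> 2 * N" "N \<ge> 2"
  shows "prime_count (2 * N) \<le> prime_count (2 * n + 1) + card {p. prime p \<and> 2 * n + 1 < p \<and> p < 2 * N}"
proof -
  have "\<not> prime (2 * N)"
    using prime_odd_nat [of "2 * N"] assms by auto
  then have "{p. prime p \<and> p \<le> 2 * N}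
      \<subseteq> {p. prime p \<and> p \<le> 2 * n + 1} \<union> {p. prime p \<and> 2 * n + 1 < p \<and> p < 2 * N}"
    by (auto simp: le_less)
  then have "prime_count (2 * N)
      \<le> card ({p. prime p \<and> p \<le> 2 * n + 1} \<union> {p. prime p \<and> 2 * n + 1 < p \<and> p < 2 * N})"
    unfolding prime_count_def
    by (intro card_mono) (auto intro: finite_subset [of _ "{..2 * N}"])
  also have "\<dots> \<le> prime_count (2 * n + 1) + card {p. prime p \<and> 2 * n + 1 < p \<and> p < 2 * N}"
    unfolding prime_count_def by (rule card_Un_le)
  finally show ?thesis .
qed

text \<open>With \<open>ln (2 * N) \<le> 12\<close> and \<open>ln 2 \<ge> 2/3\<close>, the lower
  bound gives at least \<open>(2 * N - 1) / 18\<close> primes, hence \<open>2 * n\<close> by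
  \<open>N \<ge> 18 * n\<close>, of which at most \<open>n + 1\<close> are
  \<open>\<le> 2 * n + 1\<close>.\<close>

lemma primes_suffice_if_small:
  assumes "n \<ge> 1" "18 * n \<le> N" "ln (2 * real N) \<le> 12"
  shows "n - 1 \<le> card {p. prime p \<and> 2 * n + 1 < p \<and> p < 2 * N}"
proof -
  let ?\<pi> = "prime_count (2 * N)"
  have N: "N > 0" using assms by simp
  have "(2 * real N - 1) * (2 / 3) \<le> (2 * real N - 1) * ln 2"
    using N ln_2_ge by (intro mult_left_mono) auto
  also have "\<dots> \<le> real ?\<pi> * ln (2 * real N)"
    using prime_count_lower [OF N] by (simp add: ln_4_eq algebra_simps)
  also have "\<dots> \<le> real ?\<pi> * 12"
    using assms by (intro mult_left_mono) auto
  finally have "2 * (2 * real N - 1) \<le> 36 * real ?\<pi>"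
    by simp
  then have "real (2 * N) \<le> real (18 * ?\<pi> + 1)"
    by simp
  then have "2 * N \<le> 18 * ?\<pi> + 1"
    by (simp only: of_nat_le_iff)
  then have "2 * n \<le> ?\<pi>"
    using assms by linarith
  then show ?thesis
    using prime_count_odd_le [of n] card_primes_between [of n N] assms by linarith
qed

text \<open>The upper bound at \<open>Z\<close>, about \<open>N / 9\<close>, is subtracted from the
  lower bound at \<open>2 * N\<close>; the path labels lie below \<open>Z\<close> because
  \<open>2 * n \<le> N / 9\<close>. The coefficients of \<open>N\<close> leave
  \<open>4/3 - 1/20 - 8/3 * 7/5 / 9 > 4/5\<close>.\<close>

lemma card_primes_between_lower:
  assumes "n \<ge> 1" "18 * n \<le> N" "ln (2 * real N) > 12"
  shows "4 / 5 * real N \<le> real (card {p. prime p \<and> 2 * n + 1 < p \<and> p < 2 * N}) * ln (2 * real N)"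
proof -
  define L where "L = ln (2 * real N)"
  define Z where "Z = N div 9 + 1"
  have N: "N > 0" using assms by simp
  have L: "L > 12" using assms by (simp add: L_def)
  \<comment> \<open>\<open>ln_le_sqrt\<close> forces \<open>sqrt (2 * N) \<ge> 120\<close>; this
    size absorbs the additive constants.\<close>
  have big: "N \<ge> 1000"
  proof -
    have "12 \<le> sqrt (2 * real N) / 10"
      using ln_le_sqrt [of "2 * real N"] N assms by simp
    then have "120 \<le> sqrt (2 * real N)" by simp
    then have "120\<^sup>2 \<le> 2 * real N"
      by (metis real_le_rsqrt real_sqrt_le_iff real_sqrt_abs abs_numeral)
    then show ?thesis by simp
  qed
  have Z: "2 * n + 1 \<le> Z" "real Z \<le> real N / 9 + 1" "real N / 9 \<le> real Z" "Z > 1"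
    using assms big of_nat_div_le_of_nat [of N 9] unfolding Z_def by (auto simp: field_simps)
  have Z8: "real Z \<le> real N / 8"
    using Z(2) big by simp
  \<comment> \<open>\<open>ln Z \<ge> L - ln 18 \<ge> L - 3\<close> and
    \<open>3 \<le> L / 4\<close>, so replacing \<open>ln Z\<close> by \<open>L\<close> costs a
    factor \<open>4/3\<close>.\<close>
  have lnZ: "3 / 4 * L \<le> ln (real Z)"
  proof -
    have "(13/8 :: real) ^ 6 \<le> exp (1/2) ^ 6"
      using exp_half_ge by (intro power_mono) auto
    also have "\<dots> = exp 3"
      by (simp flip: exp_of_nat_mult)
    finally have "18 \<le> exp (3::real)"
      by (rule order_trans [rotated]) (simp add: eval_nat_numeral)
    then have "ln 18 \<le> (3::real)"
      by (metis ln_exp ln_le_cancel_iff exp_gt_zero zero_less_numeral)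
    moreover have "ln (real N / 9) = L - ln 18"
    proof -
      have "ln (2 * real N / 18) = L - ln 18"
        unfolding L_def using N by (subst ln_div) auto
      then show ?thesis by simp
    qed
    ultimately have "L - 3 \<le> ln (real N / 9)"
      by linarith
    also have "\<dots> \<le> ln (real Z)"
      using Z N by (subst ln_le_cancel_iff) auto
    finally show ?thesis using L by simp
  qed
  have piZ: "real (prime_count Z) * L \<le> sqrt (real Z) * L + 8 / 3 * real Z * ln 4"
  proof -
    have "(real (prime_count Z) - sqrt (real Z)) * (3 / 4 * L) \<le> 2 * real Z * ln 4"
    proof (cases "real (prime_count Z) \<le> sqrt (real Z)")
      case True
      then have "(real (prime_count Z) - sqrt (real Z)) * (3 / 4 * L) \<le> 0"
        using L by (intro mult_nonpos_nonneg) auto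
      also have "0 \<le> 2 * real Z * ln 4" by simp
      finally show ?thesis .
    next
      case False
      then have "(real (prime_count Z) - sqrt (real Z)) * (3 / 4 * L)
          \<le> (real (prime_count Z) - sqrt (real Z)) * ln (real Z)"
        using lnZ by (intro mult_left_mono) auto
      also have "\<dots> \<le> 2 * real Z * ln 4"
        using prime_count_upper [OF Z(4)] by (simp add: algebra_simps)
      finally show ?thesis .
    qed
    then show ?thesis by (simp add: algebra_simps)
  qed
  have "sqrt (real Z) * L \<le> real N / 20"
  proof -
    have "sqrt (real Z) * L \<le> sqrt (real N / 8) * (sqrt (2 * real N) / 10)"
      using Z8 ln_le_sqrt [of "2 * real N"] N assms L
      by (intro mult_mono) (auto simp: L_def)
    also have "\<dots> = sqrt ((real N / 2)\<^sup>2) / 10"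
      by (simp add: power2_eq_square flip: real_sqrt_mult)
    also have "\<dots> = real N / 20"
      by simp
    finally show ?thesis .
  qed
  moreover have "8 / 3 * real Z * ln 4 \<le> 8 / 3 * (real N / 9 + 1) * (7 / 5)"
    using Z ln_4_less by (intro mult_mono) auto
  moreover have "(2 * real N - 1) * (2 / 3) \<le> real (prime_count (2 * N)) * L"
  proof -
    have "(2 * real N - 1) * (2 / 3) \<le> (2 * real N - 1) * ln 2"
      using N ln_2_ge by (intro mult_left_mono) auto
    also have "\<dots> \<le> real (prime_count (2 * N)) * L"
      using prime_count_lower [OF N] by (simp add: ln_4_eq L_def algebra_simps)
    finally show ?thesis .
  qed
  ultimately have "4 / 5 * real N \<le> real (prime_count (2 * N)) * L - real (prime_count Z) * L"
    using piZ big by simp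
  also have "\<dots> = (real (prime_count (2 * N)) - real (prime_count Z)) * L"
    by (simp add: algebra_simps)
  also have "\<dots> \<le> real (card {p. prime p \<and> 2 * n + 1 < p \<and> p < 2 * N}) * L"
  proof (rule mult_right_mono)
    have "prime_count (2 * N) \<le> prime_count Z + card {p. prime p \<and> 2 * n + 1 < p \<and> p < 2 * N}"
      using card_primes_between [of n N] prime_count_mono [OF Z(1)] assms by linarith
    then show "real (prime_count (2 * N)) - real (prime_count Z)
        \<le> real (card {p. prime p \<and> 2 * n + 1 < p \<and> p < 2 * N})" by linarith
  qed (use L in simp)
  finally show ?thesis by (simp add: L_def)
qed

text \<open>Up to a factor \<open>E = exp (L / 4)\<close>, a quadratic in \<open>L\<close> has to be
  beaten by \<open>E ^ 3 = exp 9 * exp (3/4 * s)\<close> with \<open>s = L - 12\<close>; the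
  quadratic Taylor polynomial of the last factor does this coefficient by coefficient.\<close>

lemma exp_beats_square:
  fixes L :: real
  assumes "L > 12"
  shows "144 * (1 + 16 * exp (L / 4) * (1 + 5 * L\<^sup>2 / (72 / 5))) \<le> 23 * exp L"
proof -
  define E where "E = exp (L / 4)"
  define s where "s = L - 12"
  have s: "s > 0" "L = s + 12" using assms by (auto simp: s_def)
  have E: "E \<ge> 1" using assms by (simp add: E_def)
  have "(13/8 :: real) ^ 18 \<le> exp (1/2) ^ 18"
    using exp_half_ge by (intro power_mono) auto
  also have "\<dots> = exp 9"
    by (simp flip: exp_of_nat_mult)
  finally have e9: "6200 \<le> exp (9::real)"
    by (rule order_trans [rotated]) (simp add: eval_nat_numeral)
  have "E ^ 3 = exp 9 * exp (3/4 * s)"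
    unfolding E_def s by (simp add: algebra_simps flip: exp_of_nat_mult exp_add)
  moreover have "1 + 3/4 * s + (3/4 * s)\<^sup>2 / 2 \<le> exp (3/4 * s)"
    using s by (intro exp_lower_Taylor_quadratic) auto
  then have "6200 * (1 + 3/4 * s + (3/4 * s)\<^sup>2 / 2) \<le> exp 9 * exp (3/4 * s)"
    using e9 s by (intro mult_mono) auto
  ultimately have E3: "6200 * (1 + 3/4 * s + (3/4 * s)\<^sup>2 / 2) \<le> E ^ 3"
    by simp
  have "144 * (1 + 16 * (1 + 5 * L\<^sup>2 / (72 / 5))) \<le> 23 * (6200 * (1 + 3/4 * s + (3/4 * s)\<^sup>2 / 2))"
    using s(1) unfolding s(2) by (simp add: power2_eq_square algebra_simps)
  also have "\<dots> \<le> 23 * E ^ 3"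
    using E3 by simp
  finally have "144 * (1 + 16 * (1 + 5 * L\<^sup>2 / (72 / 5))) * E \<le> 23 * E ^ 3 * E"
    using E by (intro mult_right_mono) auto
  moreover have "144 * (1 + 16 * E * (1 + 5 * L\<^sup>2 / (72 / 5)))
      \<le> 144 * (1 + 16 * (1 + 5 * L\<^sup>2 / (72 / 5))) * E"
    using E by (simp add: algebra_simps)
  ultimately have "144 * (1 + 16 * E * (1 + 5 * L\<^sup>2 / (72 / 5))) \<le> 23 * E ^ 3 * E"
    by (rule order_trans [rotated])
  also have "\<dots> = 23 * exp L"
    unfolding E_def by (simp flip: exp_of_nat_mult exp_add)
  finally show ?thesis
    by (simp only: E_def)
qed

text \<open>In \<open>sieve_lower_bound\<close> the totient ratio is at least \<open>1 / d\<close>,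
  so its other factor \<open>X\<close> only has to reach \<open>d * j = d * \<theta> * n\<close>.
  Since \<open>d * \<theta> \<le> 9/4\<close>, the bound \<open>9/4 * n \<le> X\<close>
  suffices.\<close>

lemma many_light_numbers:
  assumes n: "n \<ge> 1" "18 * n \<le> N" and big: "ln (2 * real N) > 12"
    and j: "j < n" "4 / 5 * real N \<le> real j * ln (2 * real N)"
  shows "j \<le> card {i \<in> {n + 1..<N}. prime_weight (2 * i + 1) \<le> 2 * real j / (5 * real n)}"
proof -
  define L where "L = ln (2 * real N)"
  define \<theta> where "\<theta> = real j / real n"
  define \<delta> where "\<delta> = 2 * \<theta> / 5"
  \<comment> \<open>Large enough that the main error \<open>N / (4 * d * \<delta>)\<close> is at
    most \<open>N / 2\<close>, small enough that the period \<open>M\<close> stays below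
    \<open>16 * (2 * N) ^ (1/4)\<close>.\<close>
  define d where "d = nat \<lceil>5 / (4 * \<theta>)\<rceil>"
  define M where "M = odd_primorial d"
  have N: "N > 0" and L: "L > 12" using n big by (auto simp: L_def)
  have "j > 0"
    using j N by (auto intro!: Nat.gr0I)
  then have \<theta>: "\<theta> > 0" "\<theta> < 1"
    using n j by (auto simp: \<theta>_def)
  have \<theta>L: "72 / 5 \<le> \<theta> * L"
  proof -
    have "72 / 5 * real n \<le> 4 / 5 * real N"
      using n by simp
    also have "\<dots> \<le> real j * L"
      using j by (simp add: L_def)
    finally show ?thesis
      using n by (simp add: \<theta>_def field_simps)
  qed
  have d: "5 / (4 * \<theta>) \<le> real d" "real d \<le> 5 / (4 * \<theta>) + 1" "d \<ge> 1"
  proof -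
    show 1: "5 / (4 * \<theta>) \<le> real d" unfolding d_def by linarith
    have "5 / (4 * \<theta>) > 0" using \<theta> by simp
    then show "real d \<le> 5 / (4 * \<theta>) + 1" unfolding d_def by linarith
    show "d \<ge> 1" using 1 \<open>5 / (4 * \<theta>) > 0\<close> by (cases d) auto
  qed
  have d\<theta>: "5 / 4 \<le> real d * \<theta>" "real d * \<theta> \<le> 9 / 4"
  proof -
    show "5 / 4 \<le> real d * \<theta>"
      using mult_right_mono [OF d(1), of \<theta>] \<theta> by simp
    have "real d * \<theta> \<le> 5 / 4 + \<theta>"
      using mult_right_mono [OF d(2), of \<theta>] \<theta> by (simp add: algebra_simps)
    then show "real d * \<theta> \<le> 9 / 4" using \<theta> by simp
  qed
  have M_le: "real M \<le> 16 * exp (L / 4)"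
  proof -
    have "M \<le> 4 ^ (2 * d)"
      unfolding M_def by (rule odd_primorial_le)
    then have "real M \<le> 4 ^ (2 * d)"
      by (metis of_nat_le_iff of_nat_numeral of_nat_power)
    also have "\<dots> = exp (real (2 * d) * ln 4)"
      by (subst exp_of_nat_mult) simp
    also have "\<dots> \<le> exp (2 * ln 4 + L / 4)"
    proof -
      \<comment> \<open>The constants fit because
        \<open>25/144 * 7/5 = 35/144 < 1/4\<close>.\<close>
      have "5 / (2 * \<theta>) \<le> 25 / 144 * L"
        using \<theta>L \<theta> by (simp add: field_simps)
      then have "real (2 * d) - 2 \<le> 25 / 144 * L"
        using d(2) by simp
      then have "(real (2 * d) - 2) * ln 4 \<le> 25 / 144 * L * ln 4"
        by (rule mult_right_mono) simp
      also have "\<dots> \<le> 25 / 144 * L * (7 / 5)"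
        using L ln_4_less by (intro mult_left_mono) auto
      also have "\<dots> \<le> L / 4"
        using L by simp
      finally show ?thesis
        by (simp add: algebra_simps)
    qed
    also have "\<dots> = 16 * exp (L / 4)"
      by (simp add: exp_add exp_double)
    finally show ?thesis .
  qed
  have M_pos: "M > 0" unfolding M_def by (rule odd_primorial_pos)
  \<comment> \<open>The budget: \<open>N - N/2 - 23/72 * N = 13/72 * N \<ge> 13/4 * n\<close>, and
    subtracting \<open>n\<close> leaves the required \<open>9/4 * n\<close>.\<close>
  have key: "real M * (1 + 5 * L / \<theta>) + 1 \<le> 23 / 72 * real N"
  proof -
    have "5 * L / \<theta> \<le> 5 * L\<^sup>2 / (72 / 5)"
      using \<theta>L \<theta> L by (simp add: field_simps power2_eq_square)
    then have "real M * (1 + 5 * L / \<theta>) \<le> 16 * exp (L / 4) * (1 + 5 * L\<^sup>2 / (72 / 5))"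
      using M_le L \<theta> by (intro mult_mono) auto
    moreover have "exp L = 2 * real N"
      using N by (simp add: L_def)
    ultimately show ?thesis
      using exp_beats_square [OF L] by simp
  qed
  define X where "X = real N - real n - 1 - real M - (real N / (4 * real d) + 2 * real M * L) / \<delta>"
  have X: "9 / 4 * real n \<le> X"
  proof -
    have "real N / (4 * real d) / \<delta> = 5 * real N / (8 * (real d * \<theta>))"
      by (simp add: \<delta>_def)
    also have "\<dots> \<le> 5 * real N / (8 * (5 / 4))"
      using d\<theta> \<theta> d by (intro divide_left_mono mult_left_mono) auto
    finally have 1: "real N / (4 * real d) / \<delta> \<le> real N / 2" by simp
    have 2: "2 * real M * L / \<delta> = real M * (5 * L / \<theta>)"
      by (simp add: \<delta>_def)
    have "X = real N - real n - 1 - real M - real N / (4 * real d) / \<delta> - real M * (5 * L / \<theta>)"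
      unfolding X_def add_divide_distrib 2 by simp
    moreover have key': "real M + real M * (5 * L / \<theta>) + 1 \<le> 23 / 72 * real N"
      using key by (simp add: distrib_left)
    moreover have n': "18 * real n \<le> real N"
      using n by simp
    ultimately show ?thesis
      using 1 by linarith
  qed
  have "real j = \<theta> * real n"
    using n by (simp add: \<theta>_def)
  also have "\<dots> \<le> (1 / real d) * X"
  proof -
    have "\<theta> * real n * real d = (real d * \<theta>) * real n" by simp
    also have "\<dots> \<le> 9 / 4 * real n"
      using d\<theta> by (intro mult_right_mono) auto
    also have "\<dots> \<le> X" by (rule X)
    finally show ?thesis using d by (simp add: field_simps)
  qed
  also have "\<dots> \<le> real (totient M) / real M * X"
  proof (rule mult_right_mono)
    have "M \<le> d * totient M"
      unfolding M_def using d by (intro odd_primorial_le_totient) simp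
    then have "real M \<le> real d * real (totient M)"
      by (metis of_nat_le_iff of_nat_mult)
    then show "1 / real d \<le> real (totient M) / real M"
      using M_pos d by (simp add: field_simps)
    show "0 \<le> X" using X by (rule order_trans [rotated]) simp
  qed
  also have "\<dots> \<le> real (card {i \<in> {n + 1..<N}. prime_weight (2 * i + 1) \<le> \<delta>})"
    unfolding X_def M_def L_def using d \<theta> n by (intro sieve_lower_bound) (auto simp: \<delta>_def)
  also have "\<delta> = 2 * real j / (5 * real n)"
    by (simp add: \<delta>_def \<theta>_def)
  finally show ?thesis
    by (simp only: of_nat_le_iff)
qed

section \<open>Long stars\<close>

lemma card_noncoprime_le:
  assumes "l > 0"
  shows "real (card {w \<in> {1..X}. \<not> coprime l w}) \<le> real X * prime_weight l"
proof -
  have "{w \<in> {1..X}. \<not> coprime l w} \<subseteq> (\<Union>p\<in>prime_factors l. (\<lambda>i. p * i) ` {1..X div p})"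
  proof
    fix w assume w: "w \<in> {w \<in> {1..X}. \<not> coprime l w}"
    then have "gcd l w \<noteq> 1" by (metis (no_types, lifting) coprime_iff_gcd_eq_1 mem_Collect_eq)
    then obtain p where p: "prime p" "p dvd l" "p dvd w"
      using prime_factor_nat [of "gcd l w"] by auto
    then obtain i where i: "w = p * i" by (auto elim: dvdE)
    have "p > 0" using p prime_gt_0_nat by blast
    then have "i \<in> {1..X div p}"
      using w i by (auto simp: less_eq_div_iff_mult_less_eq mult.commute Suc_le_eq intro!: Nat.gr0I)
    moreover have "p \<in> prime_factors l"
      using p assms by (simp add: in_prime_factors_iff)
    ultimately show "w \<in> (\<Union>p\<in>prime_factors l. (\<lambda>i. p * i) ` {1..X div p})"
      using i by blast
  qed
  then have "card {w \<in> {1..X}. \<not> coprime l w}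
      \<le> card (\<Union>p\<in>prime_factors l. (\<lambda>i. p * i) ` {1..X div p})"
    by (rule card_mono [rotated]) auto
  also have "\<dots> \<le> (\<Sum>p\<in>prime_factors l. card ((\<lambda>i. p * i) ` {1..X div p}))"
    by (rule card_UN_le) auto
  also have "\<dots> \<le> (\<Sum>p\<in>prime_factors l. X div p)"
    by (intro sum_mono order_trans [OF card_image_le]) auto
  finally have "real (card {w \<in> {1..X}. \<not> coprime l w}) \<le> real (\<Sum>p\<in>prime_factors l. X div p)"
    by (rule of_nat_mono)
  also have "\<dots> = (\<Sum>p\<in>prime_factors l. real (X div p))"
    by simp
  also have "\<dots> \<le> (\<Sum>p\<in>prime_factors l. real X * (1 / real p))"
    by (intro sum_mono) (simp add: of_nat_div_le_of_nat)
  finally show ?thesis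
    by (simp add: prime_weight_def sum_distrib_left)
qed

text \<open>\<open>G j\<close> collects the labels allowed for a centre that is served when \<open>j\<close> other centres are
  still waiting.\<close>
lemma odd_prime_firecracker_large:
  assumes n: "n \<ge> 2" and k: "k \<ge> 18"
  shows "odd_prime (firecracker_vertices n k) (firecracker_edges n k)"
proof -
  define N where "N = n * k"
  define Odd where "Odd = {l::nat. odd l \<and> l < 2 * N}"
  define V where "V = (\<lambda>i. 2 * i + 1) ` {1..n}"
  define P where "P = {p. prime p \<and> 2 * n + 1 < p \<and> p < 2 * N}"
  \<comment> \<open>The lower bound on \<open>u\<close> keeps out the path labels and 1, which is
    reserved for index 0, the centre served last.\<close>
  define G where "G j = {u. odd u \<and> 2 * n + 1 < u \<and> u < 2 * N
      \<and> card {w \<in> V. \<not> coprime u w} \<le> j \<and> card {w \<in> Odd - {u}. \<not> coprime u w} \<le> (k - 2) * j}" for j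
  have nN: "18 * n \<le> N" "2 * n < N" using n k by (auto simp: N_def)
  have fin: "finite Odd" "finite V" "finite (G j)" for j
    by (auto simp: Odd_def V_def G_def)
  have primes: "P \<subseteq> G j" if "j \<ge> 1" for j
  proof
    fix p assume "p \<in> P"
    then have p: "prime p" "2 * n + 1 < p" "p < 2 * N" by (auto simp: P_def)
    then have "odd p" using prime_odd_nat n by simp
    have "coprime p w" if "w \<in> V" for w
    proof -
      have "\<not> p dvd w" using that p(2) by (auto simp: V_def dest!: dvd_imp_le)
      then show ?thesis using p(1) by (simp add: prime_imp_coprime)
    qed
    then have "{w \<in> V. \<not> coprime p w} = {}" by blast
    then have "card {w \<in> V. \<not> coprime p w} \<le> j" by (simp only: card.empty)
    moreover have "card {w \<in> Odd - {p}. \<not> coprime p w} \<le> (k - 2) * j"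
    proof -
      \<comment> \<open>The bad labels are multiples \<open>p * m\<close> with
        \<open>m \<noteq> 1\<close>, and \<open>m < k\<close> since \<open>p > 2 * n\<close> and
        \<open>p * m < 2 * n * k\<close>.\<close>
      have "{w \<in> Odd - {p}. \<not> coprime p w} \<subseteq> (\<lambda>m. p * m) ` {2..<k}"
      proof
        fix w assume w: "w \<in> {w \<in> Odd - {p}. \<not> coprime p w}"
        then have "p dvd w" using p(1) prime_imp_coprime by blast
        then obtain m where m: "w = p * m" by (auto elim: dvdE)
        have "m \<noteq> 0" "m \<noteq> 1" using w m by (auto simp: Odd_def intro!: Nat.gr0I)
        moreover have "m < k"
        proof (rule ccontr)
          assume "\<not> m < k"
          then have "(2 * n) * k \<le> p * m"
            using p by (intro mult_mono) auto
          then show False using w m by (simp add: Odd_def N_def)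
        qed
        ultimately show "w \<in> (\<lambda>m. p * m) ` {2..<k}"
          using m by auto
      qed
      then have "card {w \<in> Odd - {p}. \<not> coprime p w} \<le> card {2..<k}"
        by (rule surj_card_le [rotated]) simp
      also have "\<dots> \<le> (k - 2) * j" using that by simp
      finally show ?thesis .
    qed
    ultimately show "p \<in> G j"
      using p \<open>odd p\<close> by (simp add: G_def)
  qed
  \<comment> \<open>The factor \<open>2/5\<close> serves both conditions:
    \<open>2/5 * (2 * n + 1) \<le> n\<close> for \<open>n \<ge> 2\<close>, and
    \<open>2/5 * (2 * k) \<le> k - 2\<close> for \<open>k \<ge> 10\<close>.\<close>
  have light: "2 * i + 1 \<in> G j"
    if i: "i \<in> {n + 1..<N}" and w: "prime_weight (2 * i + 1) \<le> 2 * real j / (5 * real n)" for i j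
  proof -
    let ?u = "2 * i + 1"
    have "real (card {w \<in> V. \<not> coprime ?u w}) \<le> real (card {w \<in> {1..2 * n + 1}. \<not> coprime ?u w})"
      by (intro of_nat_mono card_mono) (auto simp: V_def)
    also have "\<dots> \<le> real (2 * n + 1) * prime_weight ?u"
      by (rule card_noncoprime_le) simp
    also have "\<dots> \<le> real (2 * n + 1) * (2 * real j / (5 * real n))"
      using w by (intro mult_left_mono) auto
    also have "\<dots> = (2 * real (2 * n + 1) / (5 * real n)) * real j"
      by simp
    also have "\<dots> \<le> 1 * real j"
      using n by (intro mult_right_mono) (auto simp: field_simps)
    finally have 1: "card {w \<in> V. \<not> coprime ?u w} \<le> j" by simp
    have "real (card {w \<in> Odd - {?u}. \<not> coprime ?u w}) \<le> real (card {w \<in> {1..2 * N}. \<not> coprime ?u w})"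
      by (intro of_nat_mono card_mono) (auto simp: Odd_def Suc_le_eq intro!: Nat.gr0I)
    also have "\<dots> \<le> real (2 * N) * prime_weight ?u"
      by (rule card_noncoprime_le) simp
    also have "\<dots> \<le> real (2 * N) * (2 * real j / (5 * real n))"
      using w by (intro mult_left_mono) auto
    also have "\<dots> = 4 / 5 * real k * real j"
      using n by (simp add: N_def field_simps)
    also have "\<dots> \<le> real (k - 2) * real j"
      using k by (intro mult_right_mono) (auto simp: of_nat_diff)
    finally have "card {w \<in> Odd - {?u}. \<not> coprime ?u w} \<le> (k - 2) * j"
      by (metis of_nat_le_iff of_nat_mult)
    with 1 show ?thesis
      using i by (auto simp: G_def)
  qed
  have "j \<le> card (G j)" if j: "1 \<le> j" "j < n" for j
  proof (cases "j \<le> card P")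
    case True
    then show ?thesis
      using card_mono [OF fin(3) primes [OF j(1)]] by simp
  next
    case False
    \<comment> \<open>Fewer than \<open>n - 1\<close> primes are available, which forces
      \<open>ln (2 * N) > 12\<close>; and \<open>j > card P\<close> inherits the lower bound for the
      number of primes.\<close>
    have big: "ln (2 * real N) > 12"
      using primes_suffice_if_small [of n N] False j nN by (fastforce simp: P_def)
    have "4 / 5 * real N \<le> real (card P) * ln (2 * real N)"
      unfolding P_def using n nN big by (intro card_primes_between_lower) auto
    also have "\<dots> \<le> real j * ln (2 * real N)"
      using False big by (intro mult_right_mono) auto
    finally have "j \<le> card {i \<in> {n + 1..<N}. prime_weight (2 * i + 1) \<le> 2 * real j / (5 * real n)}"
      using n nN big j by (intro many_light_numbers) auto
    also have "\<dots> = card ((\<lambda>i. 2 * i + 1) ` {i \<in> {n + 1..<N}. prime_weight (2 * i + 1) \<le> 2 * real j / (5 * real n)})"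
      by (rule card_image [symmetric]) (simp add: inj_on_def)
    also have "\<dots> \<le> card (G j)"
      using light by (intro card_mono fin) blast
    finally show ?thesis .
  qed
  then obtain u where u: "u 0 = 1" "inj_on u {..<n}" "\<And>j. 1 \<le> j \<Longrightarrow> j < n \<Longrightarrow> u j \<in> G j"
    using distinct_representatives [of n G 1] fin by (auto simp: G_def)
  define U where "U = u ` {..<n}"
  define W where "W = Odd - V - U"
  have U_Odd: "U \<subseteq> Odd" and UV: "U \<inter> V = {}"
  proof -
    have "u j \<in> Odd - V" if "j < n" for j
    proof (cases "j = 0")
      case True
      then show ?thesis using u(1) nN by (auto simp: Odd_def V_def)
    next
      case False
      then have "u j \<in> G j" using u(3) that by simp
      then show ?thesis by (auto simp: G_def Odd_def V_def)
    qed
    then show "U \<subseteq> Odd" "U \<inter> V = {}" by (auto simp: U_def)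
  qed
  have V_Odd: "V \<subseteq> Odd"
    using nN by (auto simp: V_def Odd_def)
  have card_V: "card V = 1 * n"
    by (simp add: V_def card_image inj_on_def)
  have card_W: "card W = (k - 2) * n"
  proof -
    have "card U = n" using u(2) by (simp add: U_def card_image)
    moreover have "card (Odd - (V \<union> U)) = card Odd - card (V \<union> U)"
      using V_Odd U_Odd fin by (intro card_Diff_subset) (auto simp: U_def)
    moreover have "card (V \<union> U) = card V + card U"
      using UV fin by (intro card_Un_disjoint) (auto simp: U_def)
    moreover have "card Odd = n * k"
      by (simp add: Odd_def card_odd_less N_def)
    moreover have "W = Odd - (V \<union> U)" by (auto simp: W_def)
    moreover have "(k - 2) * n = n * k - 2 * n"
      using diff_mult_distrib [of k 2 n] by (simp only: mult.commute)
    ultimately show ?thesis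
      using card_V by simp
  qed
  \<comment> \<open>Each centre is matched with a path label before its position along the path is
    fixed.\<close>
  have "\<exists>f. bij_betw f ({..<n} \<times> {..<1::nat}) V \<and> (\<forall>j<n. \<forall>i<1. coprime (u j) (f (j, i)))"
  proof (rule greedy_assignment)
    fix j assume "j < n"
    then show "card {w \<in> V. \<not> coprime (u j) w} \<le> 1 * j"
      using u(1) u(3) [of j] by (cases "j = 0") (auto simp: G_def)
  qed (use card_V fin in auto)
  then obtain f where f: "bij_betw f ({..<n} \<times> {..<1::nat}) V" "\<And>j. j < n \<Longrightarrow> coprime (u j) (f (j, 0))"
    by auto
  have "\<exists>g. bij_betw g ({..<n} \<times> {..<k - 2}) W \<and> (\<forall>j<n. \<forall>i<k - 2. coprime (u j) (g (j, i)))"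
  proof (rule greedy_assignment)
    fix j assume j: "j < n"
    show "card {w \<in> W. \<not> coprime (u j) w} \<le> (k - 2) * j"
    proof (cases "j = 0")
      case False
      have "card {w \<in> W. \<not> coprime (u j) w} \<le> card {w \<in> Odd - {u j}. \<not> coprime (u j) w}"
        using fin j by (intro card_mono) (auto simp: W_def U_def)
      also have "\<dots> \<le> (k - 2) * j"
        using u(3) [of j] False j by (simp add: G_def)
      finally show ?thesis .
    qed (simp add: u)
  qed (use card_W fin in \<open>auto simp: W_def\<close>)
  then obtain g where g: "bij_betw g ({..<n} \<times> {..<k - 2}) W"
      "\<And>j i. j < n \<Longrightarrow> i < k - 2 \<Longrightarrow> coprime (u j) (g (j, i))"
    by blast
  \<comment> \<open>Position \<open>i\<close> receives the centre matched with
    \<open>2 * i + 1\<close>, so the path labels appear in increasing order, and consecutive odd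
    numbers are coprime.\<close>
  define \<sigma> where "\<sigma> i = (THE j. j < n \<and> f (j, 0) = 2 * i + 1)" for i
  have f0: "bij_betw (\<lambda>j. f (j, 0)) {..<n} V"
  proof -
    have "bij_betw (\<lambda>j. (j, 0::nat)) {..<n} ({..<n} \<times> {..<1})"
      by (auto simp: bij_betw_def inj_on_def)
    from bij_betw_trans [OF this f(1)] show ?thesis by (simp add: comp_def)
  qed
  have \<sigma>: "\<sigma> i < n \<and> f (\<sigma> i, 0) = 2 * i + 1" if "i \<in> {1..n}" for i
    unfolding \<sigma>_def
  proof (rule theI')
    have "2 * i + 1 \<in> V" using that by (auto simp: V_def)
    then show "\<exists>!j. j < n \<and> f (j, 0) = 2 * i + 1"
      using f0 by (auto simp: bij_betw_def inj_on_def image_iff)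
  qed
  have "\<sigma> ` {1..n} = {..<n}"
  proof (intro card_subset_eq)
    have "inj_on \<sigma> {1..n}"
    proof (rule inj_onI)
      fix i i' assume "i \<in> {1..n}" "i' \<in> {1..n}" "\<sigma> i = \<sigma> i'"
      then have "2 * i + 1 = 2 * i' + 1" using \<sigma> by metis
      then show "i = i'" by simp
    qed
    then show "card (\<sigma> ` {1..n}) = card {..<n}" by (simp add: card_image)
  qed (use \<sigma> in auto)
  note \<sigma>_img = this
  show ?thesis
  proof (rule odd_prime_firecrackerI [where v = "\<lambda>i. 2 * i + 1" and u = "\<lambda>i. u (\<sigma> i)"
        and w = "\<lambda>i j. g (\<sigma> i, j - 1)"])
    show "k \<ge> 3" using k by simp
    have U_img: "(\<lambda>i. u (\<sigma> i)) ` {1..n} = U"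
      unfolding U_def \<sigma>_img [symmetric] by (simp add: image_image)
    have W_img: "(\<lambda>(i, j). g (\<sigma> i, j - 1)) ` ({1..n} \<times> {1..k - 2}) = W"
    proof -
      have "(\<lambda>j. j - 1) ` {1..k - 2} = {..<k - 2}"
      proof (intro equalityI subsetI)
        fix x assume "x \<in> {..<k - 2}"
        then show "x \<in> (\<lambda>j. j - 1) ` {1..k - 2}"
          by (intro image_eqI [of _ _ "Suc x"]) auto
      qed auto
      then have "(\<lambda>(i, j). (\<sigma> i, j - 1)) ` ({1..n} \<times> {1..k - 2}) = {..<n} \<times> {..<k - 2}"
        using \<sigma>_img by (simp only: image_paired_Times)
      then have "g ` (\<lambda>(i, j). (\<sigma> i, j - 1)) ` ({1..n} \<times> {1..k - 2}) = W"
        using g(1) by (simp add: bij_betw_def)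
      then show ?thesis by (simp add: image_image case_prod_beta)
    qed
    have "V \<union> U \<union> W = {l. odd l \<and> l < 2 * (n * k)}"
      using V_Odd U_Odd unfolding W_def Odd_def N_def by blast
    then show "(\<lambda>i. 2 * i + 1) ` {1..n} \<union> (\<lambda>i. u (\<sigma> i)) ` {1..n}
        \<union> (\<lambda>(i, j). g (\<sigma> i, j - 1)) ` ({1..n} \<times> {1..k - 2}) = {l. odd l \<and> l < 2 * (n * k)}"
      unfolding U_img W_img V_def .
  next
    fix i :: nat
    show "coprime (2 * i + 1) (2 * (i + 1) + 1)"
    proof (rule coprime_odd_nearby [where D = 1])
      fix p :: nat assume "prime p" "p \<le> 1"
      then show "\<not> p dvd 2 * i + 1"
        using prime_gt_1_nat [of p] by simp
    qed auto
  next
    fix i assume "1 \<le> i" "i \<le> n"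
    then show "coprime (2 * i + 1) (u (\<sigma> i))"
      using \<sigma> [of i] f(2) [of "\<sigma> i"] by (simp add: coprime_commute)
  next
    fix i j assume "1 \<le> i" "i \<le> n" "1 \<le> j" "j \<le> k - 2"
    then show "coprime (u (\<sigma> i)) (g (\<sigma> i, j - 1))"
      using \<sigma> [of i] by (intro g(2)) auto
  qed
qed

theorem theorem4p7:
  fixes n k :: nat
  assumes "n > 1" and "k \<ge> 3"
  shows "odd_prime (firecracker_vertices n k) (firecracker_edges n k)"
  using assms odd_prime_firecracker_small odd_prime_firecracker_large
  by (cases "k \<le> 17") auto

end
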